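(* Let $\mu$ be an integral $2$-varifold in $\mathbb{R}^3$ with weak mean curvature vector $\vec{H}\in L^2(\mu)$ and with support contained in $\overline{B}$. Then $$\int \frac14 |\vec{H}|^2\,d\mu \;\ge\; \mu(\overline{B}),$$ and equality holds if and only if $\mu = k\,\mathcal{H}^2\lfloor S^2$ for some integer $k\ge 0$.
   Context: $\overline{B}$ is the closed unit ball of $\mathbb{R}^3$ centred at the origin, $S^2=\partial B$ the unit sphere, $\mathcal{H}^2$ the two-dimensional Hausdorff measure, and $\mathcal{H}^2\lfloor S^2$ its restriction to $S^2$. An integral $2$-varifold is identified with its weight measure $\mu$ on $\mathbb{R}^3$ (a Radon measure $\mu=\theta\,\mathcal{H}^2\lfloor M$ with $M$ countably $2$-rectifiable and $\theta$ positive-integer valued); $T_x\mu$ denotes the approximate tangent plane, which exists for $\mu$-a.e. $x$. $\mu$ has weak mean curvature vector $\vec{H}\in L^2(\mu)$ if $\vec H\in L^2(\mu;\mathbb{R}^3)$ and $$\int \operatorname{div}_{T_x\mu}\eta(x)\,d\mu(x) = -\int \vec{H}(x)\cdot\eta(x)\,d\mu(x)\qquad\text{for all }\eta\in C^1_c(\mathbb{R}^3;\mathbb{R}^3),$$ where $\operatorname{div}_{T_x\mu}\eta$ is the divergence along the plane $T_x\mu$. *)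

theory Defs
  imports "HOL-Analysis.Analysis"
begin

section \<open>Two-dimensional Hausdorff measure\<close>

text \<open>The normalisation \<open>\<pi> (diam U / 2)\<^sup>2\<close> makes \<open>\<H>\<^sup>2\<close> agree with the area on planes.
  Boundedness of the covering sets is required because \<^const>\<open>diameter\<close> is
  real valued and has no meaning on unbounded sets.\<close>

definition hausdorff2_pre :: "real \<Rightarrow> 'a::metric_space set \<Rightarrow> ennreal" where
  "hausdorff2_pre \<delta> A =
     (INF U \<in> {U :: nat \<Rightarrow> 'a set. A \<subseteq> (\<Union>i. U i) \<and> (\<forall>i. bounded (U i) \<and> diameter (U i) \<le> \<delta>)}.
        (\<Sum>i. ennreal (pi * (diameter (U i) / 2)\<^sup>2)))"

definition hausdorff2_outer :: "'a::metric_space set \<Rightarrow> ennreal" where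
  "hausdorff2_outer A = (SUP \<delta> \<in> {0<..}. hausdorff2_pre \<delta> A)"

definition hausdorff2 :: "'a::metric_space measure" where
  "hausdorff2 = measure_of UNIV (sets borel) hausdorff2_outer"

text \<open>Restriction \<open>\<mu>\<lfloor>A\<close>, again a measure on the whole space
  (unlike \<^const>\<open>restrict_space\<close>).\<close>

definition measure_restr :: "'a measure \<Rightarrow> 'a set \<Rightarrow> 'a measure" where
  "measure_restr \<mu> A = density \<mu> (indicator A)"

section \<open>Integral 2-varifolds in three-space\<close>

text \<open>On a Euclidean space, Borel measures that are finite on compact sets are
  automatically regular.\<close>

definition radon_measure :: "'a::euclidean_space measure \<Rightarrow> bool" where
  "radon_measure \<mu> \<longleftrightarrow> sets \<mu> = sets borel \<and> (\<forall>K. compact K \<longrightarrow> emeasure \<mu> K < \<infinity>)"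

definition countably_2_rectifiable :: "(real^3) set \<Rightarrow> bool" where
  "countably_2_rectifiable M \<longleftrightarrow>
     (\<exists>M0 (F :: nat \<Rightarrow> real^2 \<Rightarrow> real^3).
        hausdorff2_outer M0 = 0 \<and> (\<forall>j. \<exists>L. L-lipschitz_on UNIV (F j)) \<and>
        M \<subseteq> M0 \<union> (\<Union>j. range (F j)))"

text \<open>Taking \<open>M\<close> and \<open>\<theta>\<close> Borel is no loss of generality: since \<open>\<mu>\<close> is Radon and
  \<open>\<theta> \<ge> 1\<close> on \<open>M\<close>, the set \<open>M\<close> is \<open>\<sigma>\<close>-finite for \<open>\<H>\<^sup>2\<close>, so \<open>\<H>\<^sup>2\<close>-measurable
  data can be changed on an \<open>\<H>\<^sup>2\<close>-null set to become Borel.\<close>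

definition integral_2_varifold :: "(real^3) measure \<Rightarrow> bool" where
  "integral_2_varifold \<mu> \<longleftrightarrow> radon_measure \<mu> \<and>
     (\<exists>M (\<theta> :: real^3 \<Rightarrow> nat).
        M \<in> sets borel \<and> countably_2_rectifiable M \<and>
        \<theta> \<in> borel \<rightarrow>\<^sub>M count_space UNIV \<and> (\<forall>x\<in>M. \<theta> x > 0) \<and>
        \<mu> = density hausdorff2 (\<lambda>x. of_nat (\<theta> x) * indicator M x))"

definition measure_support :: "'a::topological_space measure \<Rightarrow> 'a set" where
  "measure_support \<mu> = {x. \<forall>U. open U \<and> x \<in> U \<longrightarrow> emeasure \<mu> U > 0}"

section \<open>Approximate tangent planes\<close>

definition plane2 :: "(real^3) set \<Rightarrow> bool" where
  "plane2 P \<longleftrightarrow> subspace P \<and> dim P = 2"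

text \<open>The blow-ups of \<open>\<mu>\<close> at \<open>x\<close> converge, as Radon measures, to a positive multiple
  of \<open>\<H>\<^sup>2\<lfloor>P\<close>.\<close>

definition is_approx_tangent_plane :: "(real^3) measure \<Rightarrow> real^3 \<Rightarrow> (real^3) set \<Rightarrow> bool" where
  "is_approx_tangent_plane \<mu> x P \<longleftrightarrow> plane2 P \<and>
     (\<exists>\<theta>>0. \<forall>\<phi> :: real^3 \<Rightarrow> real.
        continuous_on UNIV \<phi> \<and> compact (closure (support_on UNIV \<phi>)) \<longrightarrow>
        ((\<lambda>r. (1 / r\<^sup>2) * (\<integral>y. \<phi> ((1 / r) *\<^sub>R (y - x)) \<partial>\<mu>))
           \<longlongrightarrow> \<theta> * (\<integral>y. \<phi> y \<partial>measure_restr hausdorff2 P)) (at_right 0))"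

text \<open>The approximate tangent plane is unique where it exists, and for an integral
  2-varifold it exists almost everywhere. On the exceptional null set the value is
  some fixed plane, irrelevant to integrals with respect to the completed measure.\<close>

definition tangent_plane :: "(real^3) measure \<Rightarrow> real^3 \<Rightarrow> (real^3) set" where
  "tangent_plane \<mu> x =
     (if \<exists>P. is_approx_tangent_plane \<mu> x P then SOME P. is_approx_tangent_plane \<mu> x P
      else SOME P. plane2 P)"

section \<open>Weak mean curvature\<close>

text \<open>The sum does not depend on the chosen orthonormal basis: it is the trace over \<open>P\<close>
  of the derivative of \<open>\<eta>\<close>.\<close>

definition div_along :: "(real^3) set \<Rightarrow> (real^3 \<Rightarrow> real^3) \<Rightarrow> real^3 \<Rightarrow> real" where
  "div_along P \<eta> x =
     (let B = (SOME B. pairwise orthogonal B \<and> (\<forall>b\<in>B. norm b = 1) \<and> span B = P)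
      in \<Sum>b\<in>B. frechet_derivative \<eta> (at x) b \<bullet> b)"

definition C1_compact_support :: "('a::euclidean_space \<Rightarrow> 'b::euclidean_space) \<Rightarrow> bool" where
  "C1_compact_support \<eta> \<longleftrightarrow>
     (\<exists>\<eta>' :: 'a \<Rightarrow> 'a \<Rightarrow>\<^sub>L 'b.
        (\<forall>x. (\<eta> has_derivative blinfun_apply (\<eta>' x)) (at x)) \<and> continuous_on UNIV \<eta>') \<and>
     compact (closure (support_on UNIV \<eta>))"

text \<open>Measurability and integrals refer to the completion, since \<open>tangent_plane \<mu>\<close> is only
  determined \<open>\<mu>\<close>-almost everywhere. For Borel integrands this makes no difference.\<close>

definition weak_mean_curvature_L2 :: "(real^3) measure \<Rightarrow> (real^3 \<Rightarrow> real^3) \<Rightarrow> bool" where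
  "weak_mean_curvature_L2 \<mu> H \<longleftrightarrow>
     H \<in> borel_measurable (completion \<mu>) \<and>
     integrable (completion \<mu>) (\<lambda>x. (norm (H x))\<^sup>2) \<and>
     (\<forall>\<eta>. C1_compact_support \<eta> \<longrightarrow>
        has_bochner_integral (completion \<mu>) (\<lambda>x. div_along (tangent_plane \<mu> x) \<eta> x)
          (- (\<integral>x. H x \<bullet> \<eta> x \<partial>completion \<mu>)))"

end

theory Submission
  imports Defs
begin

text \<open>Testing the first variation with the field \<open>x\<close> gives \<open>- \<integral> H \<bullet> x = 2 \<mu>(B)\<close>, hence
  \<open>0 \<le> \<integral> |H + 2 x|\<^sup>2 = \<integral> |H|\<^sup>2 - 8 \<mu>(B) + 4 \<integral> |x|\<^sup>2 \<le> \<integral> |H|\<^sup>2 - 4 \<mu>(B)\<close>. Equality forces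
  \<open>|x| = 1\<close> and \<open>H = - 2 x\<close> almost everywhere.

  If \<open>\<mu>\<close> lives on the sphere, the field \<open>(|x|\<^sup>2 - 1) x\<close> has divergence \<open>2 |P x|\<^sup>2\<close> there, where
  \<open>P\<close> is the projection onto the approximate tangent plane, and it vanishes on the sphere. So
  \<open>P x = 0\<close> and the tangent planes are those of the sphere, without any blow-up argument. The fields
  \<open>f A x\<close> with \<open>A\<close> antisymmetric then have divergence \<open>Df(A x)\<close>, the derivative of \<open>f\<close> along the
  rotations generated by \<open>A\<close>. Hence \<open>H\<close> is radial if and only if \<open>\<mu>\<close> is invariant under rotations,
  that is (both measures being uniformly distributed on the sphere) a multiple of the Hausdorff
  measure of the sphere. This replaces the constancy theorem; the factor is a value of the
  multiplicity and therefore an integer.\<close>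

section \<open>Finite Borel measures on Euclidean space\<close>

lemma finite_borel_integrable:
  fixes f :: "'a::euclidean_space \<Rightarrow> 'b::{banach, second_countable_topology}"
  assumes M: "finite_measure M" "sets M = sets borel" and K: "compact K" "AE x in M. x \<in> K"
    and f: "continuous_on UNIV f"
  shows "integrable M f"
proof -
  interpret finite_measure M by fact
  have "compact (f ` K)"
    using K f by (meson compact_continuous_image continuous_on_subset top_greatest)
  then obtain B where B: "\<And>x. x \<in> K \<Longrightarrow> norm (f x) \<le> B"
    by (meson bounded_iff compact_imp_bounded imageI)
  show ?thesis
  proof (rule integrable_const_bound)
    show "AE x in M. norm (f x) \<le> B"
      using K(2) by eventually_elim (rule B)
    show "f \<in> borel_measurable M"
      using f M(2) borel_measurable_continuous_onI measurable_cong_sets by blast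
  qed
qed

text \<open>Closed sets generate the Borel sets and are stable under intersection. The indicator of
  a closed set is a pointwise limit of continuous functions bounded by 1, so dominated convergence
  recovers its measure.\<close>

lemma finite_borel_measure_eqI:
  fixes M N :: "'a::euclidean_space measure"
  assumes M: "finite_measure M" "sets M = sets borel" and N: "finite_measure N" "sets N = sets borel"
    and eq: "\<And>f :: 'a \<Rightarrow> real. continuous_on UNIV f \<Longrightarrow> integral\<^sup>L M f = integral\<^sup>L N f"
  shows "M = N"
proof (rule measure_eqI_generator_eq[where E = "Collect closed" and \<Omega> = UNIV and A = "\<lambda>_. UNIV"])
  interpret M: finite_measure M by fact
  interpret N: finite_measure N by fact
  have sp: "space M = UNIV" "space N = UNIV"
    using sets_eq_imp_space_eq[OF M(2)] sets_eq_imp_space_eq[OF N(2)] by auto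
  show "emeasure M UNIV \<noteq> \<infinity>" using M.emeasure_finite by auto
  fix C :: "'a set" assume "C \<in> Collect closed"
  then have C: "closed C" by simp
  show "emeasure M C = emeasure N C"
  \<comment> \<open>The empty set is split off because \<open>infdist\<close> to it is 0 by
    convention, which would make every \<open>f n\<close> equal to 1.\<close>
  proof (cases "C = {}")
    case False
    define f where "f n x = max 0 (1 - real n * infdist x C)" for n x
    have f01: "norm (f n x) \<le> 1" for n x
      by (auto simp: f_def infdist_nonneg max_def mult_nonneg_nonneg)
    have cont: "continuous_on UNIV (f n)" for n
      unfolding f_def by (intro continuous_intros)
    have lim: "(\<lambda>n. f n x) \<longlonglongrightarrow> indicator C x" for x
    proof (cases "x \<in> C")
      case True then show ?thesis by (simp add: f_def)
    next
      case False
      then have d: "infdist x C > 0"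
        using C \<open>C \<noteq> {}\<close> infdist_pos_not_in_closed by blast
      obtain m :: nat where m: "1 < real m * infdist x C"
        using reals_Archimedean3[OF d] by blast
      have "\<forall>\<^sub>F n in sequentially. f n x = 0"
        using eventually_ge_at_top[of m]
      proof eventually_elim
        case (elim n)
        have "real m * infdist x C \<le> real n * infdist x C"
          using elim d by (intro mult_right_mono) auto
        with m show ?case by (simp add: f_def)
      qed
      then show ?thesis using False by (simp add: tendsto_eventually)
    qed
    have conv: "(\<lambda>n. integral\<^sup>L L (f n)) \<longlonglongrightarrow> measure L C"
      if L: "finite_measure L" "sets L = sets borel" for L :: "'a measure"
    proof -
      interpret finite_measure L by fact
      have meas: "f n \<in> borel_measurable L" for n
        using cont[of n] L(2) borel_measurable_continuous_onI measurable_cong_sets by blast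
      have CL: "C \<in> sets L" using C L by simp
      have "(\<lambda>n. integral\<^sup>L L (f n)) \<longlonglongrightarrow> integral\<^sup>L L (indicator C :: 'a \<Rightarrow> real)"
        by (rule integral_dominated_convergence[where w = "\<lambda>_. 1"])
          (use f01 lim CL meas in auto)
      then show ?thesis using CL by (simp add: sets.Int_space_eq1)
    qed
    have "measure M C = measure N C"
      using LIMSEQ_unique[OF conv[OF M]] conv[OF N] eq[OF cont] by simp
    then show ?thesis by (simp add: M.emeasure_eq_measure N.emeasure_eq_measure)
  qed simp
qed (auto simp: Int_stable_def M N borel_eq_closed)

text \<open>By Stone-Weierstrass, polynomials approximate a continuous function uniformly on the
  compact set \<open>K\<close> carrying both measures; the error is controlled by the total
  masses.\<close>

lemma finite_borel_measure_eqI_polynomial: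
  fixes M N :: "'a::euclidean_space measure"
  assumes M: "finite_measure M" "sets M = sets borel" "AE x in M. x \<in> K"
    and N: "finite_measure N" "sets N = sets borel" "AE x in N. x \<in> K"
    and K: "compact K"
    and eq: "\<And>p. real_polynomial_function p \<Longrightarrow> integral\<^sup>L M p = integral\<^sup>L N p"
  shows "M = N"
proof (rule finite_borel_measure_eqI)
  fix f :: "'a \<Rightarrow> real" assume f: "continuous_on UNIV f"
  have close: "\<bar>integral\<^sup>L L f - integral\<^sup>L L p\<bar> \<le> e * measure L UNIV"
    if L: "finite_measure L" "sets L = sets borel" "AE x in L. x \<in> K"
      and p: "continuous_on UNIV p" and e: "\<And>x. x \<in> K \<Longrightarrow> \<bar>f x - p x\<bar> < e" for L e and p :: "'a \<Rightarrow> real"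
  proof -
    interpret finite_measure L by fact
    have sp: "space L = UNIV"
      using sets_eq_imp_space_eq[OF L(2)] by auto
    have i: "integrable L f" "integrable L p"
      by (rule finite_borel_integrable[OF L(1,2) K L(3)], fact)+
    have "\<bar>integral\<^sup>L L f - integral\<^sup>L L p\<bar> = \<bar>\<integral>x. f x - p x \<partial>L\<bar>"
      using i by simp
    also have "\<dots> \<le> (\<integral>x. \<bar>f x - p x\<bar> \<partial>L)" by (rule integral_abs_bound)
    also have "\<dots> \<le> (\<integral>x. e \<partial>L)"
    proof (rule integral_mono_AE)
      show "AE x in L. \<bar>f x - p x\<bar> \<le> e"
        using L(3) by eventually_elim (use e in force)
    qed (use i in auto)
    finally show ?thesis by (simp add: sp mult.commute)
  qed
  define m where "m = measure M UNIV + measure N UNIV"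
  have "\<bar>integral\<^sup>L M f - integral\<^sup>L N f\<bar> \<le> e * m" if e: "e > 0" for e
  proof -
    obtain p where p: "real_polynomial_function p" "\<And>x. x \<in> K \<Longrightarrow> \<bar>f x - p x\<bar> < e"
      using Stone_Weierstrass_real_polynomial_function[OF K continuous_on_subset[OF f top_greatest] e] by blast
    have cp: "continuous_on UNIV p"
      using p(1) continuous_on_polymonial_function real_polynomial_function_eq by blast
    show ?thesis
      using close[OF M cp p(2)] close[OF N cp p(2)] eq[OF p(1)] by (simp add: m_def algebra_simps)
  qed
  moreover have "m \<ge> 0" by (simp add: m_def)
  \<comment> \<open>Dividing by \<open>m + 1\<close> instead of \<open>m\<close> covers the case of
    zero total mass.\<close>
  moreover have "e / (m + 1) * m \<le> e" if "e > 0" for e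
    using that \<open>m \<ge> 0\<close> by (simp add: field_simps)
  ultimately have *: "\<bar>integral\<^sup>L M f - integral\<^sup>L N f\<bar> \<le> 0 + e" if "e > 0" for e
    using that by (metis add_0 add_nonneg_pos divide_pos_pos order_trans zero_less_one)
  show "integral\<^sup>L M f = integral\<^sup>L N f"
    using field_le_epsilon[of "\<bar>integral\<^sup>L M f - integral\<^sup>L N f\<bar>" 0] * by simp
qed (use M N in auto)

text \<open>The positive and negative parts of \<open>g\<close> are densities of two finite measures
  that agree on polynomials. The measures coincide, hence so do the two parts almost everywhere,
  which leaves only \<open>g = 0\<close>.\<close>

lemma AE_eq_0_if_polynomial_integrals_0:
  fixes g :: "'a::euclidean_space \<Rightarrow> real"
  assumes M: "finite_measure M" "sets M = sets borel" "AE x in M. x \<in> K" and K: "compact K"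
    and g: "integrable M g"
    and 0: "\<And>p. real_polynomial_function p \<Longrightarrow> (\<integral>x. p x * g x \<partial>M) = 0"
  shows "AE x in M. g x = 0"
proof -
  \<comment> \<open>The sign \<open>s\<close> is 1 or -1 and selects the positive or the negative
    part of \<open>g\<close>.\<close>
  define N where "N s = density M (\<lambda>x. ennreal (max 0 (s * g x)))" for s
  have gm[measurable]: "g \<in> borel_measurable M" using g by simp
  have fin: "finite_measure (N s)" for s
  proof
    have "integrable M (\<lambda>x. max 0 (s * g x))" using g by auto
    then show "emeasure (N s) (space (N s)) \<noteq> \<infinity>"
      unfolding N_def
      by (subst emeasure_density) (auto simp: nn_integral_eq_integral cong: nn_integral_cong)
  qed
  have ae: "AE x in N s. x \<in> K" for s
    unfolding N_def using M(3) K M(2) by (subst AE_density) auto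
  have "N 1 = N (-1)"
  proof (rule finite_borel_measure_eqI_polynomial[OF fin _ ae fin _ ae K])
    fix p :: "'a \<Rightarrow> real" assume p: "real_polynomial_function p"
    have cp: "continuous_on UNIV p"
      using p continuous_on_polymonial_function real_polynomial_function_eq by blast
    then have pm[measurable]: "p \<in> borel_measurable M"
      using M(2) borel_measurable_continuous_onI measurable_cong_sets by blast
    have "integrable (N s) p" for s
      using finite_borel_integrable[OF fin _ K ae cp, of s] M(2) by (simp add: N_def)
    then have int: "integrable M (\<lambda>x. max 0 (s * g x) * p x)" for s
      unfolding N_def by (subst (asm) integrable_density) auto
    have "integral\<^sup>L (N s) p = (\<integral>x. max 0 (s * g x) * p x \<partial>M)" for s
      unfolding N_def by (subst integral_density) auto
    then have "integral\<^sup>L (N 1) p - integral\<^sup>L (N (-1)) p = (\<integral>x. max 0 (1 * g x) * p x - max 0 ((-1) * g x) * p x \<partial>M)"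
      using int[of 1] int[of "-1"] by simp
    also have "\<dots> = (\<integral>x. p x * g x \<partial>M)"
      by (intro Bochner_Integration.integral_cong) (auto simp: max_def)
    finally show "integral\<^sup>L (N 1) p = integral\<^sup>L (N (-1)) p" using 0[OF p] by simp
  qed (auto simp: N_def M)
  then have "AE x in M. ennreal (max 0 (1 * g x)) = ennreal (max 0 (-1 * g x))"
    unfolding N_def using fin[of 1, unfolded N_def]
    by (subst (asm) finite_density_unique) (auto simp: emeasure_density finite_measure.emeasure_finite dest!: finite_measure.emeasure_finite[where A = "space M"])
  then show ?thesis
    by eventually_elim (auto simp: max_def split: if_splits)
qed

subsection \<open>Uniformly distributed measures\<close>

text \<open>Christensen's argument: integrate \<open>f x - f y\<close> over the pairs at distance at most \<open>r\<close>
  with respect to the product measure and let \<open>r\<close> tend to 0.\<close>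

lemma uniformly_distributed_measures_proportional:
  fixes M N :: "'a::euclidean_space measure"
  assumes M: "finite_measure M" "sets M = sets borel" "AE x in M. x \<in> S"
    and N: "finite_measure N" "sets N = sets borel" "AE x in N. x \<in> S"
    and S: "compact S"
    and uM: "\<And>x y r. x \<in> S \<Longrightarrow> y \<in> S \<Longrightarrow> measure M (cball x r) = measure M (cball y r)"
    and uN: "\<And>x y r. x \<in> S \<Longrightarrow> y \<in> S \<Longrightarrow> measure N (cball x r) = measure N (cball y r)"
    and pos: "measure N UNIV > 0"
  shows "M = scale_measure (ennreal (measure M UNIV / measure N UNIV)) N"
proof -
  interpret M: finite_measure M by fact
  interpret N: finite_measure N by fact
  interpret P: pair_sigma_finite M N by unfold_locales
  have sp: "space M = UNIV" "space N = UNIV"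
    using sets_eq_imp_space_eq[OF M(2)] sets_eq_imp_space_eq[OF N(2)] by auto
  have "sets (M \<Otimes>\<^sub>M N) = sets (borel \<Otimes>\<^sub>M borel)"
    using M N by (intro sets_pair_measure_cong) auto
  then have sP: "sets (M \<Otimes>\<^sub>M N) = sets (borel :: ('a \<times> 'a) measure)"
    by (metis borel_prod)
  define m n where "m = measure M UNIV" and "n = measure N UNIV"
  have n: "n > 0" using pos by (simp add: n_def)
  have m: "m \<ge> 0" by (simp add: m_def)
  have "S \<noteq> {}"
  proof
    assume "S = {}"
    with N(3) have "AE x in N. False" by simp
    then have "emeasure N (space N) = 0" using AE_iff_measurable[of "space N" N "\<lambda>_. False"] by auto
    with pos show False by (simp add: sp measure_def)
  qed
  then obtain z where z: "z \<in> S" by blast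
  define a b where "a r = measure M (cball z r)" and "b r = measure N (cball z r)" for r
  \<comment> \<open>If one ball of radius \<open>r\<close> centred in \<open>S\<close> is null,
    uniformity makes all of them null; finitely many of them cover \<open>S\<close>, so
    \<open>N\<close> would vanish.\<close>
  have bpos: "b r > 0" if "r > 0" for r
  proof (rule ccontr)
    assume "\<not> b r > 0"
    then have "b r = 0" by (simp add: b_def measure_nonneg order_class.order.antisym not_less)
    then have *: "measure N (cball x r) = 0" if "x \<in> S" for x using uN[OF that z] by (simp add: b_def)
    obtain T where T: "finite T" "T \<subseteq> S" "S \<subseteq> (\<Union>x\<in>T. ball x r)"
      using compactE_image[OF S, of S "\<lambda>x. ball x r"] \<open>r > 0\<close> by (metis UN_I centre_in_ball open_ball subsetI)
    have "measure N UNIV \<le> measure N (\<Union>x\<in>T. cball x r)"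
    proof (rule N.finite_measure_mono_AE)
      show "AE x in N. x \<in> UNIV \<longrightarrow> x \<in> (\<Union>x\<in>T. cball x r)"
        using N(3) by eventually_elim (use T(3) ball_subset_cball in blast)
      show "(\<Union>x\<in>T. cball x r) \<in> sets N" using T(1) by (intro sets.finite_UN) (simp_all add: N(2))
    qed
    also have "\<dots> \<le> (\<Sum>x\<in>T. measure N (cball x r))"
      using T(1) N(2) by (intro measure_UNION_le) auto
    also have "\<dots> = 0" using T(2) * by (intro sum.neutral) auto
    finally show False using pos by simp
  qed
  define k where "k r = (\<lambda>(x, y). indicat_real {p. dist (fst p) (snd p) \<le> r} (x, y :: 'a))" for r
  have km[measurable]: "k r \<in> borel_measurable (M \<Otimes>\<^sub>M N)" for r
  proof -
    have "closed {p :: 'a \<times> 'a. dist (fst p) (snd p) \<le> r}"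
      by (intro closed_Collect_le continuous_intros)
    then have "{p :: 'a \<times> 'a. dist (fst p) (snd p) \<le> r} \<in> sets (M \<Otimes>\<^sub>M N)"
      using sP by simp
    then show ?thesis by (simp add: k_def split_beta')
  qed
  have k1: "\<bar>k r p\<bar> \<le> 1" for r p by (auto simp: k_def split_beta indicator_def)
  \<comment> \<open>Fubini in both orders. The inner integral of the kernel is the mass of a ball,
    which does not depend on its centre in \<open>S\<close> and therefore comes out as the constant
    \<open>b r\<close> or \<open>a r\<close>.\<close>
  have fub: "b r * (\<integral>x. f x \<partial>M) = (\<integral>p. k r p * f (fst p) \<partial>(M \<Otimes>\<^sub>M N))"
     "a r * (\<integral>y. f y \<partial>N) = (\<integral>p. k r p * f (snd p) \<partial>(M \<Otimes>\<^sub>M N))"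
     "integrable (M \<Otimes>\<^sub>M N) (\<lambda>p. k r p * f (fst p))"
     "integrable (M \<Otimes>\<^sub>M N) (\<lambda>p. k r p * f (snd p))"
    if f: "continuous_on UNIV f" for f :: "'a \<Rightarrow> real" and r
  proof -
    have fm: "f \<in> borel_measurable borel" using f by (rule borel_measurable_continuous_onI)
    have [measurable]: "f \<in> borel_measurable M" "f \<in> borel_measurable N"
      using fm M(2) N(2) measurable_cong_sets by blast+
    have ifM: "integrable M f" by (rule finite_borel_integrable[OF M(1,2) S M(3) f])
    have ifN: "integrable N f" by (rule finite_borel_integrable[OF N(1,2) S N(3) f])
    have "integrable (M \<Otimes>\<^sub>M N) (\<lambda>p. f (fst p) * 1)"
      by (rule P.Fubini_integrable) (use ifM in auto)
    then show i1: "integrable (M \<Otimes>\<^sub>M N) (\<lambda>p. k r p * f (fst p))"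
      by (rule Bochner_Integration.integrable_bound) (use k1 in \<open>auto simp: abs_mult mult_left_le_one_le\<close>)
    have "integrable (M \<Otimes>\<^sub>M N) (\<lambda>p. 1 * f (snd p))"
      by (rule P.Fubini_integrable) (use ifN in auto)
    then show i2: "integrable (M \<Otimes>\<^sub>M N) (\<lambda>p. k r p * f (snd p))"
      by (rule Bochner_Integration.integrable_bound) (use k1 in \<open>auto simp: abs_mult mult_left_le_one_le\<close>)
    have kx: "(\<integral>y. k r (x, y) \<partial>N) = b r" if "x \<in> S" for x
    proof -
      have "(\<integral>y. k r (x, y) \<partial>N) = (\<integral>y. indicat_real (cball x r) y \<partial>N)"
        by (intro Bochner_Integration.integral_cong) (auto simp: k_def indicator_def)
      also have "\<dots> = b r" using N(2) uN[OF that z] by (simp add: b_def sp)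
      finally show ?thesis .
    qed
    have ky: "(\<integral>x. k r (x, y) \<partial>M) = a r" if "y \<in> S" for y
    proof -
      have "(\<integral>x. k r (x, y) \<partial>M) = (\<integral>x. indicat_real (cball y r) x \<partial>M)"
        by (intro Bochner_Integration.integral_cong) (auto simp: k_def indicator_def dist_commute)
      also have "\<dots> = a r" using M(2) uM[OF that z] by (simp add: a_def sp)
      finally show ?thesis .
    qed
    have "(\<integral>p. k r p * f (fst p) \<partial>(M \<Otimes>\<^sub>M N)) = (\<integral>x. (\<integral>y. k r (x, y) * f x \<partial>N) \<partial>M)"
      using P.integral_fst'[OF i1] by simp
    also have "\<dots> = (\<integral>x. b r * f x \<partial>M)"
    proof (rule integral_cong_AE)
      show "AE x in M. (\<integral>y. k r (x, y) * f x \<partial>N) = b r * f x"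
        using M(3) by eventually_elim (simp add: kx)
    qed measurable
    finally show "b r * (\<integral>x. f x \<partial>M) = (\<integral>p. k r p * f (fst p) \<partial>(M \<Otimes>\<^sub>M N))" by simp
    have "(\<integral>p. k r p * f (snd p) \<partial>(M \<Otimes>\<^sub>M N)) = (\<integral>y. (\<integral>x. k r (x, y) * f y \<partial>M) \<partial>N)"
      using P.integral_snd[of "\<lambda>x y. k r (x, y) * f y"] i2 by (simp add: split_beta')
    also have "\<dots> = (\<integral>x. a r * f x \<partial>N)"
    proof (rule integral_cong_AE)
      show "AE x in N. (\<integral>y. k r (y, x) * f x \<partial>M) = a r * f x"
        using N(3) by eventually_elim (simp add: ky)
    qed measurable
    finally show "a r * (\<integral>y. f y \<partial>N) = (\<integral>p. k r p * f (snd p) \<partial>(M \<Otimes>\<^sub>M N))" by simp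
  qed
  \<comment> \<open>Taking \<open>f = 1\<close> gives the same ratio of ball masses at every scale
    \<open>r\<close>, so no limit of \<open>a r / b r\<close> has to be studied.\<close>
  have ab: "b r * m = a r * n" for r
    using fub(1,2)[of "\<lambda>_. 1" r] by (simp add: sp m_def n_def)
  have eq: "n * (\<integral>x. f x \<partial>M) = m * (\<integral>x. f x \<partial>N)" if f: "continuous_on UNIV f" for f :: "'a \<Rightarrow> real"
  proof -
    have est: "\<bar>n * (\<integral>x. f x \<partial>M) - m * (\<integral>x. f x \<partial>N)\<bar> \<le> (m * n) * e" if "e > 0" for e
    proof -
      have "uniformly_continuous_on S f"
        by (intro compact_uniformly_continuous S continuous_on_subset[OF f]) auto
      then obtain r' where r': "r' > 0" "\<And>x y. x \<in> S \<Longrightarrow> y \<in> S \<Longrightarrow> dist x y < r' \<Longrightarrow> dist (f x) (f y) < e"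
        unfolding uniformly_continuous_on_def using \<open>e > 0\<close> by metis
      \<comment> \<open>Halving turns the strict inequality of uniform continuity into the
        non-strict one built into \<open>k r\<close>.\<close>
      define r where "r = r' / 2"
      have r: "r > 0" "\<And>x y. x \<in> S \<Longrightarrow> y \<in> S \<Longrightarrow> dist x y \<le> r \<Longrightarrow> \<bar>f x - f y\<bar> \<le> e"
        using r' by (force simp: r_def dist_real_def)+
      have aeS: "AE p in M \<Otimes>\<^sub>M N. fst p \<in> S \<and> snd p \<in> S"
      proof (rule P.AE_pair_measure)
        show "{p \<in> space (M \<Otimes>\<^sub>M N). fst p \<in> S \<and> snd p \<in> S} \<in> sets (M \<Otimes>\<^sub>M N)"
        proof -
          have "{p \<in> space (M \<Otimes>\<^sub>M N). fst p \<in> S \<and> snd p \<in> S} = S \<times> S" by (auto simp: space_pair_measure sp)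
          moreover have "S \<in> sets M" "S \<in> sets N" using borel_compact[OF S] M(2) N(2) by auto
          ultimately show ?thesis by simp
        qed
        show "AE x in M. AE y in N. fst (x, y) \<in> S \<and> snd (x, y) \<in> S"
          using M(3)
        proof eventually_elim
          case (elim x)
          show ?case using N(3) by eventually_elim (use elim in simp)
        qed
      qed
      note i = fub(3,4)[OF f, of r] fub(3)[of "\<lambda>_. 1" r]
      have "\<bar>b r * (\<integral>x. f x \<partial>M) - a r * (\<integral>x. f x \<partial>N)\<bar>
          = \<bar>\<integral>p. k r p * f (fst p) - k r p * f (snd p) \<partial>(M \<Otimes>\<^sub>M N)\<bar>"
        using i fub(1,2)[OF f, of r] by simp
      also have "\<dots> \<le> (\<integral>p. \<bar>k r p * f (fst p) - k r p * f (snd p)\<bar> \<partial>(M \<Otimes>\<^sub>M N))" by (rule integral_abs_bound)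
      also have "\<dots> \<le> (\<integral>p. e * (k r p * 1) \<partial>(M \<Otimes>\<^sub>M N))"
      proof (rule integral_mono_AE)
        show "AE p in M \<Otimes>\<^sub>M N. \<bar>k r p * f (fst p) - k r p * f (snd p)\<bar> \<le> e * (k r p * 1)"
          using aeS by eventually_elim (use r(2) in \<open>auto simp: k_def split_beta indicator_def\<close>)
      qed (use i in auto)
      also have "\<dots> = e * (b r * m)" using fub(1)[of "\<lambda>_. 1" r] by (simp add: m_def sp)
      finally have "n * \<bar>b r * (\<integral>x. f x \<partial>M) - a r * (\<integral>x. f x \<partial>N)\<bar> \<le> n * (e * (b r * m))"
        using n by (intro mult_left_mono) auto
      \<comment> \<open>Multiplying by \<open>n\<close> lets \<open>ab\<close> replace
        \<open>a r * n\<close> by \<open>b r * m\<close>; the common factor \<open>b r\<close> is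
        positive and cancels afterwards.\<close>
      moreover have "n * \<bar>b r * (\<integral>x. f x \<partial>M) - a r * (\<integral>x. f x \<partial>N)\<bar> = b r * \<bar>n * (\<integral>x. f x \<partial>M) - m * (\<integral>x. f x \<partial>N)\<bar>"
      proof -
        have "n * (b r * (\<integral>x. f x \<partial>M) - a r * (\<integral>x. f x \<partial>N)) = b r * (n * (\<integral>x. f x \<partial>M)) - (a r * n) * (\<integral>x. f x \<partial>N)"
          by (simp add: algebra_simps)
        also have "\<dots> = b r * (n * (\<integral>x. f x \<partial>M) - m * (\<integral>x. f x \<partial>N))"
          by (simp only: ab[symmetric]) (simp add: algebra_simps)
        finally have "\<bar>n * (b r * (\<integral>x. f x \<partial>M) - a r * (\<integral>x. f x \<partial>N))\<bar> = \<bar>b r * (n * (\<integral>x. f x \<partial>M) - m * (\<integral>x. f x \<partial>N))\<bar>"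
          by simp
        then show ?thesis using n bpos[OF r(1)] by (simp add: abs_mult)
      qed
      ultimately have "b r * \<bar>n * (\<integral>x. f x \<partial>M) - m * (\<integral>x. f x \<partial>N)\<bar> \<le> b r * ((m * n) * e)"
        by (simp add: algebra_simps)
      then show ?thesis using bpos[OF r(1)] by simp
    qed
    have "\<bar>n * (\<integral>x. f x \<partial>M) - m * (\<integral>x. f x \<partial>N)\<bar> \<le> 0 + e" if "e > 0" for e
    proof -
      have mn: "m * n \<ge> 0" using m n by simp
      have "(m * n) * (e / (m * n + 1)) \<le> e" using mn that by (simp add: divide_simps)
      with est[of "e / (m * n + 1)"] mn that show ?thesis by simp
    qed
    then show ?thesis using field_le_epsilon[of "\<bar>n * (\<integral>x. f x \<partial>M) - m * (\<integral>x. f x \<partial>N)\<bar>" 0] by simp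
  qed
  have sc: "scale_measure (ennreal (m / n)) N = density N (\<lambda>_. ennreal (m / n))"
    by (rule measure_eqI) (auto simp: emeasure_density nn_integral_cmult)
  have "M = density N (\<lambda>_. ennreal (m / n))"
  proof (rule finite_borel_measure_eqI[OF M(1,2)])
    show "finite_measure (density N (\<lambda>_. ennreal (m / n)))"
      by (rule finite_measureI) (auto simp: emeasure_density nn_integral_cmult ennreal_mult_eq_top_iff)
    show "sets (density N (\<lambda>_. ennreal (m / n))) = sets borel" using N by simp
    fix f :: "'a \<Rightarrow> real" assume f: "continuous_on UNIV f"
    then have "f \<in> borel_measurable borel" by (rule borel_measurable_continuous_onI)
    then have [measurable]: "f \<in> borel_measurable N"
      using N(2) measurable_cong_sets by blast
    have "integral\<^sup>L (density N (\<lambda>_. ennreal (m / n))) f = (m / n) * integral\<^sup>L N f"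
      using m n by (subst integral_density) auto
    then show "integral\<^sup>L M f = integral\<^sup>L (density N (\<lambda>_. ennreal (m / n))) f"
      using eq[OF f] n by (simp add: field_simps del: times_divide_eq_left) (metis less_irrefl mult_left_cancel)
  qed
  then show ?thesis using sc by (simp add: m_def n_def)
qed

section \<open>Continuously differentiable maps\<close>

text \<open>Continuity of the derivative is asked for one direction \<open>v\<close> at a time,
  which suits explicit derivative formulas. In finite dimension this amounts to continuity in the
  operator norm.\<close>

definition C1_deriv :: "('a::euclidean_space \<Rightarrow> 'b::euclidean_space) \<Rightarrow> ('a \<Rightarrow> 'a \<Rightarrow> 'b) \<Rightarrow> bool" where
  "C1_deriv f f' \<longleftrightarrow> (\<forall>x. (f has_derivative f' x) (at x)) \<and> (\<forall>v. continuous_on UNIV (\<lambda>x. f' x v))"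

lemma C1_derivD:
  assumes "C1_deriv f f'"
  shows "(f has_derivative f' x) (at x)" "continuous_on UNIV (\<lambda>x. f' x v)" "continuous_on UNIV f"
    "bounded_linear (f' x)"
  using assms unfolding C1_deriv_def
  by (auto intro: has_derivative_bounded_linear has_derivative_continuous continuous_at_imp_continuous_on)

text \<open>A linear map on a Euclidean space is controlled by its values on the basis, so
  directional continuity gives the continuity of the \<open>Blinfun\<close> derivative required by
  \<open>C1_compact_support\<close>.\<close>

lemma C1_deriv_blinfun:
  assumes "C1_deriv f f'"
  shows "continuous_on UNIV (\<lambda>x. Blinfun (f' x))" "blinfun_apply (Blinfun (f' x)) = f' x"
proof -
  show *: "blinfun_apply (Blinfun (f' x)) = f' x" for x
    by (simp add: bounded_linear_Blinfun_apply C1_derivD(4)[OF assms])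
  show "continuous_on UNIV (\<lambda>x. Blinfun (f' x))"
    by (rule continuous_on_blinfun_componentwise) (simp add: * C1_derivD(2)[OF assms])
qed

lemma C1_deriv_continuous_apply:
  assumes "C1_deriv f f'" "continuous_on S g" "continuous_on S h"
  shows "continuous_on S (\<lambda>x. f' (g x) (h x))"
proof -
  have "continuous_on S (\<lambda>x. blinfun_apply (Blinfun (f' (g x))) (h x))"
    using continuous_on_compose2[OF C1_deriv_blinfun(1)[OF assms(1)] assms(2)] assms(3)
    by (intro continuous_intros) auto
  then show ?thesis by (simp add: C1_deriv_blinfun(2)[OF assms(1)])
qed

lemma C1_deriv_const: "C1_deriv (\<lambda>x. c) (\<lambda>x v. 0)"
  by (auto simp: C1_deriv_def)

lemma C1_deriv_bounded_linear: "bounded_linear f \<Longrightarrow> C1_deriv f (\<lambda>x. f)"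
  by (auto simp: C1_deriv_def bounded_linear_imp_has_derivative)

lemma C1_deriv_add:
  assumes "C1_deriv f f'" "C1_deriv g g'"
  shows "C1_deriv (\<lambda>x. f x + g x) (\<lambda>x v. f' x v + g' x v)"
  using assms unfolding C1_deriv_def by (auto intro!: has_derivative_add continuous_intros)

lemma C1_deriv_scaleR:
  fixes f :: "'a::euclidean_space \<Rightarrow> real"
  assumes "C1_deriv f f'" "C1_deriv g g'"
  shows "C1_deriv (\<lambda>x. f x *\<^sub>R g x) (\<lambda>x v. f x *\<^sub>R g' x v + f' x v *\<^sub>R g x)"
  unfolding C1_deriv_def
  using C1_derivD[OF assms(1)] C1_derivD[OF assms(2)] by (auto intro!: has_derivative_scaleR continuous_intros)

lemma C1_deriv_comp_linear:
  assumes "C1_deriv f f'" "bounded_linear R"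
  shows "C1_deriv (\<lambda>x. f (R x)) (\<lambda>x v. f' (R x) (R v))"
  unfolding C1_deriv_def
proof safe
  fix x v
  show "((\<lambda>x. f (R x)) has_derivative (\<lambda>v. f' (R x) (R v))) (at x)"
    by (rule has_derivative_compose[OF bounded_linear_imp_has_derivative[OF assms(2)] C1_derivD(1)[OF assms(1)]])
  show "continuous_on UNIV (\<lambda>x. f' (R x) (R v))"
    using continuous_on_compose2[OF C1_derivD(2)[OF assms(1), of "R v"] linear_continuous_on[OF assms(2)]] by simp
qed

lemma real_polynomial_function_C1:
  fixes p :: "'a::euclidean_space \<Rightarrow> real"
  assumes "real_polynomial_function p"
  shows "\<exists>p'. C1_deriv p p'"
  using assms
proof induction
  case (mult f g)
  then show ?case using C1_deriv_scaleR[of f _ g] by force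
qed (blast intro: C1_deriv_bounded_linear C1_deriv_const C1_deriv_add)+

lemma C1_deriv_norm_sq: "C1_deriv (\<lambda>x::'a::euclidean_space. x \<bullet> x) (\<lambda>x v. 2 * (x \<bullet> v))"
  unfolding C1_deriv_def
  by (auto intro!: derivative_eq_intros continuous_intros simp: inner_commute)

section \<open>A continuously differentiable cutoff function\<close>

lemma has_real_derivative_max0_sq: "((\<lambda>t::real. (max 0 t)\<^sup>2) has_real_derivative 2 * max 0 t) (at t)"
proof (cases t "0::real" rule: linorder_cases)
  case less
  have "((\<lambda>t::real. 0) has_real_derivative 2 * max 0 t) (at t)" using less by simp
  then show ?thesis
    by (rule DERIV_cong_ev[THEN iffD1, rotated -1])
      (use less eventually_nhds_in_open[of "{..<0}" t] in \<open>auto elim!: eventually_mono\<close>)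
next
  case greater
  have "((\<lambda>t::real. t\<^sup>2) has_real_derivative 2 * max 0 t) (at t)" using greater
    by (auto intro!: derivative_eq_intros)
  then show ?thesis
    by (rule DERIV_cong_ev[THEN iffD1, rotated -1])
      (use greater eventually_nhds_in_open[of "{0<..}" t] in \<open>auto elim!: eventually_mono\<close>)
next
  case equal
  \<comment> \<open>At the corner the difference quotient of the squared function is
    \<open>max 0 h\<close> itself, for either sign of \<open>h\<close>.\<close>
  have "(\<lambda>h. max 0 h) \<midarrow>0\<rightarrow> (0::real)" using tendsto_max[OF tendsto_const tendsto_ident_at, of 0 "0::real" UNIV] by simp
  then have "(\<lambda>h. (max 0 h)\<^sup>2 / h) \<midarrow>0\<rightarrow> (0::real)"
    by (rule Lim_transform_eventually) (auto simp: max_def power2_eq_square eventually_at_filter)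
  then show ?thesis using equal by (simp add: DERIV_def)
qed

text \<open>Squaring smooths both corners. The threshold \<open>x \<bullet> x = 2\<close> lies
  strictly outside the closed unit ball, so the function is 1 on a neighbourhood of that
  ball.\<close>

definition cutoff :: "'a::euclidean_space \<Rightarrow> real" where
  "cutoff x = (max 0 (1 - (max 0 (x \<bullet> x - 2))\<^sup>2))\<^sup>2"

lemma cutoff_eq_1: "x \<bullet> x \<le> 2 \<Longrightarrow> cutoff x = 1" by (simp add: cutoff_def)

lemma cutoff_eq_0:
  assumes "x \<bullet> x > 3" shows "cutoff x = 0"
proof -
  have "1 \<le> (x \<bullet> x - 2)\<^sup>2" using assms by (intro one_le_power) auto
  then show ?thesis using assms by (simp add: cutoff_def)
qed

lemma C1_deriv_cutoff: "\<exists>c'. C1_deriv (cutoff :: 'a::euclidean_space \<Rightarrow> real) c'"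
proof -
  define h' where "h' s = 2 * max 0 (1 - (max 0 (s - 2))\<^sup>2) * (- (2 * max 0 (s - 2)))" for s :: real
  have h: "((\<lambda>s. (max 0 (1 - (max 0 (s - 2))\<^sup>2))\<^sup>2) has_real_derivative h' s) (at s)" for s
  proof -
    have 1: "((\<lambda>s. (max 0 (s - 2))\<^sup>2) has_real_derivative 2 * max 0 (s - 2)) (at s)"
      using DERIV_chain'[OF DERIV_diff[OF DERIV_ident DERIV_const[of 2]] has_real_derivative_max0_sq, of s] by simp
    have 2: "((\<lambda>s. 1 - (max 0 (s - 2))\<^sup>2) has_real_derivative - (2 * max 0 (s - 2))) (at s)"
      using DERIV_diff[OF DERIV_const[of 1] 1] by simp
    show ?thesis unfolding h'_def using DERIV_chain'[OF 2 has_real_derivative_max0_sq]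
      by (simp add: mult.commute)
  qed
  have "((cutoff :: 'a \<Rightarrow> real) has_derivative (\<lambda>v. h' (x \<bullet> x) * (2 * (x \<bullet> v)))) (at x)" for x
    unfolding cutoff_def
    using has_derivative_compose[OF C1_derivD(1)[OF C1_deriv_norm_sq] h[unfolded has_field_derivative_def]] .
  moreover have "continuous_on UNIV (\<lambda>x::'a. h' (x \<bullet> x) * (2 * (x \<bullet> v)))" for v
    unfolding h'_def by (intro continuous_intros)
  ultimately have "C1_deriv cutoff (\<lambda>x::'a. \<lambda>v. h' (x \<bullet> x) * (2 * (x \<bullet> v)))"
    by (simp add: C1_deriv_def)
  then show ?thesis by blast
qed

text \<open>Turns fields defined globally, such as the identity, into admissible test
  fields.\<close>

lemma C1_compact_support_cutoff:
  assumes "C1_deriv \<eta> \<eta>'"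
  shows "C1_compact_support (\<lambda>x. cutoff x *\<^sub>R \<eta> x)"
proof -
  obtain c' where c': "C1_deriv (cutoff :: 'a \<Rightarrow> real) c'" using C1_deriv_cutoff by blast
  note C = C1_deriv_scaleR[OF c' assms]
  have "support_on UNIV (\<lambda>x. cutoff x *\<^sub>R \<eta> x) \<subseteq> cball 0 2"
  proof
    fix x assume "x \<in> support_on UNIV (\<lambda>x. cutoff x *\<^sub>R \<eta> x)"
    then have "cutoff x \<noteq> 0" by (auto simp: support_on_def)
    then have "x \<bullet> x \<le> 3" using cutoff_eq_0[of x] by fastforce
    then have "(norm x)\<^sup>2 \<le> 2\<^sup>2" by (simp add: dot_square_norm)
    then have "norm x \<le> 2" by (rule power2_le_imp_le) simp
    then show "x \<in> cball 0 2" by simp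
  qed
  then have "compact (closure (support_on UNIV (\<lambda>x. cutoff x *\<^sub>R \<eta> x)))"
    by (simp add: bounded_subset[OF bounded_cball])
  then show ?thesis
    unfolding C1_compact_support_def
    using C1_deriv_blinfun[OF C] C1_derivD(1)[OF C]
    by (intro conjI exI[of _ "\<lambda>x. Blinfun (\<lambda>v. cutoff x *\<^sub>R \<eta>' x v + c' x v *\<^sub>R \<eta> x)"]) auto
qed

text \<open>The two fields agree on the open set \<open>y \<bullet> y < 2\<close> around
  \<open>x\<close>, not only on the closed ball, so their derivatives at \<open>x\<close> agree
  too.\<close>

lemma frechet_derivative_cutoff:
  assumes "C1_deriv \<eta> \<eta>'" "norm x \<le> 1"
  shows "frechet_derivative (\<lambda>x. cutoff x *\<^sub>R \<eta> x) (at x) = \<eta>' x"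
proof -
  have "(\<eta> has_derivative \<eta>' x) (at x)" by (rule C1_derivD(1)[OF assms(1)])
  moreover have "open {y :: 'a. y \<bullet> y < 2}" by (intro open_Collect_less continuous_intros)
  moreover have "x \<in> {y. y \<bullet> y < 2}" using assms(2) by (simp add: dot_square_norm power_le_one order_le_less_trans[of _ 1])
  ultimately have "((\<lambda>x. cutoff x *\<^sub>R \<eta> x) has_derivative \<eta>' x) (at x)"
    by (rule has_derivative_transform_within_open) (simp add: cutoff_eq_1)
  then show ?thesis by (metis frechet_derivative_at)
qed

section \<open>Plane rotations\<close>

text \<open>An antisymmetric map: for orthonormal \<open>u\<close> and \<open>v\<close>, the
  infinitesimal rotation of their plane, which kills the orthogonal complement.\<close>

definition rot_gen :: "'a::euclidean_space \<Rightarrow> 'a \<Rightarrow> 'a \<Rightarrow> 'a" where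
  "rot_gen u v x = (u \<bullet> x) *\<^sub>R v - (v \<bullet> x) *\<^sub>R u"

text \<open>For orthonormal \<open>u\<close> and \<open>v\<close> this is the exponential of
  \<open>t\<close> times \<open>rot_gen u v\<close>, in closed form because the square of the
  generator is minus the projection onto the plane.\<close>

definition rotation :: "'a::euclidean_space \<Rightarrow> 'a \<Rightarrow> real \<Rightarrow> 'a \<Rightarrow> 'a" where
  "rotation u v t x = x + (cos t - 1) *\<^sub>R ((u \<bullet> x) *\<^sub>R u + (v \<bullet> x) *\<^sub>R v) + sin t *\<^sub>R rot_gen u v x"

lemma bounded_linear_rot_gen: "bounded_linear (rot_gen u v)"
  unfolding rot_gen_def
  by (intro bounded_linear_sub bounded_linear_scaleR_const bounded_linear_inner_right)

lemma bounded_linear_rotation: "bounded_linear (rotation u v t)"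
  unfolding rotation_def
  by (intro bounded_linear_add bounded_linear_ident bounded_linear_scaleR_const bounded_linear_inner_right bounded_linear_rot_gen bounded_linear_const_scaleR)

lemma rot_gen_antisym: "rot_gen u v x \<bullet> y = - (rot_gen u v y \<bullet> x)"
  by (simp add: rot_gen_def inner_diff_left inner_diff_right inner_commute algebra_simps)

lemma rot_gen_self: "rot_gen u v x \<bullet> x = 0"
  using rot_gen_antisym[of u v x x] by simp

lemma rotation_0: "rotation u v 0 x = x"
  by (simp add: rotation_def)

lemma rotation_has_vector_derivative:
  assumes uv: "norm u = 1" "norm v = 1" "u \<bullet> v = 0"
  shows "((\<lambda>t. rotation u v t x) has_vector_derivative rot_gen u v (rotation u v t x)) (at t)"
proof -
  have [simp]: "u \<bullet> u = 1" "v \<bullet> v = 1" "u \<bullet> v = 0" "v \<bullet> u = 0"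
    using uv by (simp_all add: dot_square_norm inner_commute)
  have "((\<lambda>t. rotation u v t x) has_vector_derivative
      (- sin t) *\<^sub>R ((u \<bullet> x) *\<^sub>R u + (v \<bullet> x) *\<^sub>R v) + cos t *\<^sub>R rot_gen u v x) (at t)"
    unfolding rotation_def
    by (auto intro!: derivative_eq_intros simp: has_real_derivative_iff_has_vector_derivative[symmetric])
  also have "(- sin t) *\<^sub>R ((u \<bullet> x) *\<^sub>R u + (v \<bullet> x) *\<^sub>R v) + cos t *\<^sub>R rot_gen u v x
     = rot_gen u v (rotation u v t x)"
    by (simp add: rotation_def rot_gen_def inner_add_right inner_diff_right algebra_simps)
  finally show ?thesis .
qed

lemma rotation_rot_gen_commute:
  assumes uv: "norm u = 1" "norm v = 1" "u \<bullet> v = 0"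
  shows "rotation u v t (rot_gen u v x) = rot_gen u v (rotation u v t x)"
proof -
  have [simp]: "u \<bullet> u = 1" "v \<bullet> v = 1" "u \<bullet> v = 0" "v \<bullet> u = 0"
    using uv by (simp_all add: dot_square_norm inner_commute)
  show ?thesis
    by (simp add: rotation_def rot_gen_def inner_add_right inner_diff_right algebra_simps)
qed

text \<open>On the coordinates \<open>u \<bullet> x\<close> and \<open>v \<bullet> x\<close> the map
  acts as a rotation of the Euclidean plane, and it leaves the orthogonal part fixed. The identities
  \<open>coeff\<close> express that the two planar rotations cancel.\<close>

lemma rotation_inverse:
  assumes uv: "norm u = 1" "norm v = 1" "u \<bullet> v = 0"
  shows "rotation u v (- t) (rotation u v t x) = x"
proof -
  have [simp]: "u \<bullet> u = 1" "v \<bullet> v = 1" "u \<bullet> v = 0" "v \<bullet> u = 0"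
    using uv by (simp_all add: dot_square_norm inner_commute)
  have "(sin t)\<^sup>2 + (cos t)\<^sup>2 = 1" by simp
  then have coeff: "(cos t - 1) * (cos t * a - sin t * b) + sin t * (cos t * b + sin t * a)
      = - ((cos t - 1) * a - sin t * b)"
    "(cos t - 1) * (cos t * b + sin t * a) - sin t * (cos t * a - sin t * b)
      = - ((cos t - 1) * b + sin t * a)" for a b
    by algebra+
  have rot: "rotation u v t x = x + ((cos t - 1) * (u \<bullet> x) - sin t * (v \<bullet> x)) *\<^sub>R u
      + ((cos t - 1) * (v \<bullet> x) + sin t * (u \<bullet> x)) *\<^sub>R v" for t x
    by (simp add: rotation_def rot_gen_def algebra_simps)
  have "u \<bullet> rotation u v t x = cos t * (u \<bullet> x) - sin t * (v \<bullet> x)"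
       "v \<bullet> rotation u v t x = cos t * (v \<bullet> x) + sin t * (u \<bullet> x)"
    by (simp_all add: rot inner_add_right algebra_simps)
  then have "rotation u v (- t) (rotation u v t x) = rotation u v t x
     + ((cos t - 1) * (cos t * (u \<bullet> x) - sin t * (v \<bullet> x)) + sin t * (cos t * (v \<bullet> x) + sin t * (u \<bullet> x))) *\<^sub>R u
     + ((cos t - 1) * (cos t * (v \<bullet> x) + sin t * (u \<bullet> x)) - sin t * (cos t * (u \<bullet> x) - sin t * (v \<bullet> x))) *\<^sub>R v"
    by (subst rot[of "- t"]) simp
  then show ?thesis by (simp only: coeff rot[of t x]) (simp only: scaleR_minus_left, simp)
qed

text \<open>The squared norm is constant in \<open>t\<close>, since its derivative pairs
  \<open>rot_gen u v y\<close> with \<open>y\<close> and the generator is antisymmetric.\<close>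

lemma norm_rotation:
  assumes uv: "norm u = 1" "norm v = 1" "u \<bullet> v = 0"
  shows "norm (rotation u v t x) = norm x"
proof -
  have "((\<lambda>t. rotation u v t x \<bullet> rotation u v t x) has_real_derivative 0) (at t)" for t :: real
  proof -
    have r: "((\<lambda>t. rotation u v t x) has_derivative (\<lambda>h. h *\<^sub>R rot_gen u v (rotation u v t x))) (at t)"
      using rotation_has_vector_derivative[OF uv] by (simp add: has_vector_derivative_def)
    show ?thesis
      using has_derivative_inner[OF r r]
      by (simp add: has_field_derivative_def rot_gen_self inner_commute[of _ "rot_gen _ _ _"] lambda_zero)
  qed
  then have "rotation u v t x \<bullet> rotation u v t x = rotation u v 0 x \<bullet> rotation u v 0 x"
    using DERIV_isconst_all by blast
  then show ?thesis by (simp add: rotation_0 norm_eq)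
qed

lemma dist_rotation:
  assumes uv: "norm u = 1" "norm v = 1" "u \<bullet> v = 0"
  shows "dist (rotation u v t x) (rotation u v t y) = dist x y"
  using norm_rotation[OF uv, of t "x - y"]
  by (simp add: dist_norm linear_diff[OF bounded_linear.linear[OF bounded_linear_rotation]])

text \<open>Rotate in the plane of \<open>x\<close> and \<open>y\<close>: the second axis
  \<open>v\<close> is the normalised component \<open>w\<close> of \<open>y\<close> orthogonal to
  \<open>x\<close>, and \<open>t\<close> is the angle between them, up to the choice in
  \<open>[0, 2 pi)\<close>.\<close>

lemma rotation_transitive:
  fixes x y :: "'a::euclidean_space"
  assumes x: "norm x = 1" and y: "norm y = 1" and dim: "DIM('a) \<ge> 2"
  obtains u v t where "norm u = 1" "norm v = 1" "u \<bullet> v = 0" "rotation u v t x = y"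
proof -
  define w where "w = y - (x \<bullet> y) *\<^sub>R x"
  have xx: "x \<bullet> x = 1" "y \<bullet> y = 1" using x y by (simp_all add: dot_square_norm)
  have xw: "x \<bullet> w = 0" by (simp add: w_def inner_diff_right xx)
  obtain v where v: "norm v = 1" "x \<bullet> v = 0" "w = norm w *\<^sub>R v"
  proof (cases "w = 0")
    \<comment> \<open>Here \<open>y\<close> is a multiple of \<open>x\<close>; any unit vector
      orthogonal to \<open>x\<close> serves as second axis, and one exists in dimension at least
      2.\<close>
    case True
    obtain v where "v \<noteq> 0" "orthogonal x v"
      using orthogonal_to_vector_exists[OF dim] by blast
    then have "norm (v /\<^sub>R norm v) = 1" "x \<bullet> (v /\<^sub>R norm v) = 0" by (auto simp: orthogonal_def)
    then show ?thesis by (rule that) (simp add: True)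
  next
    case False
    then show ?thesis using xw by (intro that[of "w /\<^sub>R norm w"]) auto
  qed
  have wn: "w \<bullet> w = 1 - (x \<bullet> y)\<^sup>2"
    by (simp add: w_def inner_diff_right inner_diff_left xx inner_commute power2_eq_square)
  then have "(x \<bullet> y)\<^sup>2 + (norm w)\<^sup>2 = 1" by (simp add: dot_square_norm)
  then obtain t where t: "x \<bullet> y = cos t" "norm w = sin t"
    using sincos_total_2pi by metis
  have "rotation x v t x = y"
  proof -
    have "rotation x v t x = cos t *\<^sub>R x + sin t *\<^sub>R v"
      using v by (simp add: rotation_def rot_gen_def xx inner_commute algebra_simps)
    also have "\<dots> = (x \<bullet> y) *\<^sub>R x + w" using t v(3) by simp
    finally show ?thesis by (simp add: w_def)
  qed
  then show ?thesis using that x v by blast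
qed

section \<open>Integrals along rotations and infinitesimal invariance\<close>

lemma integral_rotation_has_derivative:
  fixes M :: "'a::euclidean_space measure" and f :: "'a \<Rightarrow> real"
  assumes M: "finite_measure M" "sets M = sets borel" "AE x in M. norm x \<le> 1"
    and uv: "norm u = 1" "norm v = 1" "u \<bullet> v = 0" and f: "C1_deriv f f'"
  shows "((\<lambda>t. \<integral>x. f (rotation u v t x) \<partial>M) has_real_derivative
    (\<integral>x. f' (rotation u v t x) (rot_gen u v (rotation u v t x)) \<partial>M)) (at t)"
proof -
  interpret finite_measure M by fact
  have M3: "AE x in M. x \<in> cball 0 1" using M(3) by simp
  have contR: "continuous_on UNIV (rotation u v t)" for t
    by (rule linear_continuous_on[OF bounded_linear_rotation])
  have contfR: "continuous_on UNIV (\<lambda>x. f (rotation u v t x))" for t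
    using continuous_on_compose2[OF C1_derivD(3)[OF f] contR] by simp
  have int: "integrable M (\<lambda>x. f (rotation u v t x))" for t
    by (rule finite_borel_integrable[OF M(1,2) compact_cball M3 contfR])
  define g where "g y = f' y (rot_gen u v y)" for y
  have contg: "continuous_on UNIV g"
    unfolding g_def by (intro C1_deriv_continuous_apply[OF f] continuous_on_id linear_continuous_on bounded_linear_rot_gen)
  then have "compact (g ` cball 0 1)"
    by (meson compact_cball compact_continuous_image continuous_on_subset top_greatest)
  then obtain B where B: "\<And>y. norm y \<le> 1 \<Longrightarrow> \<bar>g y\<bar> \<le> B"
    using compact_imp_bounded bounded_real by (metis imageI mem_cball_0)
  have deriv: "((\<lambda>t. f (rotation u v t x)) has_real_derivative g (rotation u v t x)) (at t)" for x t
  proof -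
    have "((\<lambda>t. f (rotation u v t x)) has_derivative (\<lambda>h. f' (rotation u v t x) (h *\<^sub>R rot_gen u v (rotation u v t x)))) (at t)"
      by (rule has_derivative_compose[OF rotation_has_vector_derivative[OF uv, unfolded has_vector_derivative_def] C1_derivD(1)[OF f]])
    then show ?thesis
      using linear_scale[OF bounded_linear.linear[OF C1_derivD(4)[OF f]]]
      by (simp add: has_field_derivative_def g_def mult_commute_abs)
  qed
  \<comment> \<open>Mean value estimate along the orbit. Rotations keep \<open>x\<close> in the unit
    ball, so the bound \<open>B\<close> holds at all times and dominates the difference
    quotients.\<close>
  have lip: "\<bar>(f (rotation u v (t + h) x) - f (rotation u v t x)) / h\<bar> \<le> B" if "norm x \<le> 1" "h \<noteq> 0" for x h
  proof -
    have "norm (f (rotation u v (t + h) x) - f (rotation u v t x)) \<le> B * norm (t + h - t)"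
      by (rule field_differentiable_bound[where S = UNIV and f = "\<lambda>t. f (rotation u v t x)" and f' = "\<lambda>t. g (rotation u v t x)"])
        (use deriv B that in \<open>auto simp: norm_rotation[OF uv]\<close>)
    then show ?thesis using that by (simp add: abs_divide divide_le_eq)
  qed
  show ?thesis
    \<comment> \<open>The limit is taken along arbitrary null sequences, the form in which dominated
      convergence applies.\<close>
    unfolding DERIV_def tendsto_at_iff_sequentially
  proof safe
    fix X :: "nat \<Rightarrow> real" assume X: "\<forall>i. X i \<in> UNIV - {0}" "X \<longlonglongrightarrow> 0"
    have "(\<lambda>i. \<integral>x. (f (rotation u v (t + X i) x) - f (rotation u v t x)) / X i \<partial>M) \<longlonglongrightarrow> (\<integral>x. g (rotation u v t x) \<partial>M)"
    proof (rule integral_dominated_convergence[where w = "\<lambda>_. B"])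
      show "(\<lambda>x. g (rotation u v t x)) \<in> borel_measurable M"
        using continuous_on_compose2[OF contg contR subset_UNIV] M(2) borel_measurable_continuous_onI measurable_cong_sets by blast
      show "(\<lambda>x. (f (rotation u v (t + X i) x) - f (rotation u v t x)) / X i) \<in> borel_measurable M" for i
        using int by simp
      show "AE x in M. (\<lambda>i. (f (rotation u v (t + X i) x) - f (rotation u v t x)) / X i) \<longlonglongrightarrow> g (rotation u v t x)"
        using deriv[of _ t, unfolded DERIV_def tendsto_at_iff_sequentially] X by (simp add: comp_def)
      show "AE x in M. norm ((f (rotation u v (t + X i) x) - f (rotation u v t x)) / X i) \<le> B" for i
        using M(3) by eventually_elim (use lip X in auto)
    qed simp
    then show "((\<lambda>h. ((\<integral>x. f (rotation u v (t + h) x) \<partial>M) - (\<integral>x. f (rotation u v t x) \<partial>M)) / h) \<circ> X)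
       \<longlonglongrightarrow> (\<integral>x. f' (rotation u v t x) (rot_gen u v (rotation u v t x)) \<partial>M)"
      using int by (simp add: comp_def g_def)
  qed
qed

lemma measurable_rotation: "rotation u v t \<in> borel_measurable borel"
  by (rule borel_measurable_continuous_onI, rule linear_continuous_on, rule bounded_linear_rotation)

text \<open>The infinitesimal form of invariance. One direction differentiates the constant integral
  of \<open>f\<close> over rotated points at time 0; the other shows that such integrals are
  constant in time for polynomials, which determine the measure.\<close>

lemma rotation_invariant_iff:
  fixes M :: "'a::euclidean_space measure"
  assumes M: "finite_measure M" "sets M = sets borel" "AE x in M. norm x \<le> 1"
    and uv: "norm u = 1" "norm v = 1" "u \<bullet> v = 0"
  shows "(\<forall>t. distr M borel (rotation u v t) = M) \<longleftrightarrow>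
     (\<forall>(f::'a \<Rightarrow> real) f'. C1_deriv f f' \<longrightarrow> (\<integral>x. f' x (rot_gen u v x) \<partial>M) = 0)"
proof safe
  have [measurable]: "rotation u v t \<in> borel_measurable M" for t
    using measurable_rotation M(2) measurable_cong_sets by blast
  {
    fix f :: "'a \<Rightarrow> real" and f' assume inv: "\<forall>t. distr M borel (rotation u v t) = M" and f: "C1_deriv f f'"
    have fm: "f \<in> borel_measurable borel" by (rule borel_measurable_continuous_onI[OF C1_derivD(3)[OF f]])
    have "(\<integral>x. f (rotation u v t x) \<partial>M) = integral\<^sup>L (distr M borel (rotation u v t)) f" for t
      by (rule integral_distr[symmetric]) (use fm in measurable)
    then have "((\<lambda>t. integral\<^sup>L M f) has_real_derivative (\<integral>x. f' x (rot_gen u v x) \<partial>M)) (at 0)"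
      using integral_rotation_has_derivative[OF M uv f, of 0] inv by (simp add: rotation_0)
    then show "(\<integral>x. f' x (rot_gen u v x) \<partial>M) = 0"
      using DERIV_unique DERIV_const by blast
  }
  fix t
  assume 0: "\<forall>(f::'a \<Rightarrow> real) f'. C1_deriv f f' \<longrightarrow> (\<integral>x. f' x (rot_gen u v x) \<partial>M) = 0"
  show "distr M borel (rotation u v t) = M"
  proof (rule finite_borel_measure_eqI_polynomial)
    show "finite_measure (distr M borel (rotation u v t))"
      using M(1) by (intro finite_measure.finite_measure_distr) measurable
    show "AE x in M. x \<in> cball 0 1" using M(3) by simp
    show "AE x in distr M borel (rotation u v t). x \<in> cball 0 1"
      using M(3) by (subst AE_distr_iff) (auto simp: norm_rotation[OF uv])
    fix p :: "'a \<Rightarrow> real" assume "real_polynomial_function p"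
    then obtain p' where p: "C1_deriv p p'" using real_polynomial_function_C1 by blast
    have pm: "p \<in> borel_measurable borel" by (rule borel_measurable_continuous_onI[OF C1_derivD(3)[OF p]])
    have "((\<lambda>t. \<integral>x. p (rotation u v t x) \<partial>M) has_real_derivative 0) (at t)" for t
    proof -
      \<comment> \<open>The hypothesis is applied to \<open>p\<close> composed with the rotation by
        \<open>t\<close>. Since rotation and generator commute, this integral is the derivative at
        time \<open>t\<close>.\<close>
      have "(\<integral>x. p' (rotation u v t x) (rotation u v t (rot_gen u v x)) \<partial>M) = 0"
        using 0 C1_deriv_comp_linear[OF p bounded_linear_rotation[of u v t]] by blast
      then show ?thesis
        using integral_rotation_has_derivative[OF M uv p, of t] by (simp add: rotation_rot_gen_commute[OF uv])
    qed
    then have "(\<integral>x. p (rotation u v t x) \<partial>M) = (\<integral>x. p (rotation u v 0 x) \<partial>M)"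
      using DERIV_isconst_all[of "\<lambda>t. \<integral>x. p (rotation u v t x) \<partial>M"] by blast
    then show "integral\<^sup>L (distr M borel (rotation u v t)) p = integral\<^sup>L M p"
      using pm by (subst integral_distr) (auto simp: rotation_0)
  qed (use M in auto)
qed

section \<open>Tangent planes\<close>

text \<open>The very choice term inside \<open>div_along\<close>, so that the divergence unfolds to
  a sum over this basis.\<close>

definition plane_basis :: "(real^3) set \<Rightarrow> (real^3) set" where
  "plane_basis P = (SOME B. pairwise orthogonal B \<and> (\<forall>b\<in>B. norm b = 1) \<and> span B = P)"

lemma plane_basis:
  assumes "plane2 P"
  shows "pairwise orthogonal (plane_basis P)" "\<And>b. b \<in> plane_basis P \<Longrightarrow> norm b = 1"
    "span (plane_basis P) = P" "finite (plane_basis P)" "card (plane_basis P) = 2"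
proof -
  have "subspace P" "dim P = 2" using assms by (auto simp: plane2_def)
  then have "\<exists>B. pairwise orthogonal B \<and> (\<forall>b\<in>B. norm b = 1) \<and> span B = P"
    using orthonormal_basis_subspace[of P] by metis
  then have *: "pairwise orthogonal (plane_basis P) \<and> (\<forall>b\<in>plane_basis P. norm b = 1) \<and> span (plane_basis P) = P"
    unfolding plane_basis_def by (rule someI_ex)
  then show "pairwise orthogonal (plane_basis P)" "\<And>b. b \<in> plane_basis P \<Longrightarrow> norm b = 1"
    "span (plane_basis P) = P" by auto
  have "independent (plane_basis P)"
    using * by (intro pairwise_orthogonal_independent) auto
  then show "finite (plane_basis P)" "card (plane_basis P) = 2"
    using * \<open>dim P = 2\<close> dim_span_eq_card_independent[of "plane_basis P"]
    by (auto simp: independent_imp_finite)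
qed

text \<open>This is the divergence of the identity field along the plane.\<close>

lemma plane_basis_trace:
  assumes "plane2 P"
  shows "(\<Sum>b\<in>plane_basis P. b \<bullet> b) = 2"
proof -
  have "(\<Sum>b\<in>plane_basis P. b \<bullet> b) = (\<Sum>b\<in>plane_basis P. 1)"
    by (rule sum.cong) (auto simp: dot_square_norm plane_basis(2)[OF assms])
  then show ?thesis by (simp add: plane_basis(5)[OF assms])
qed

text \<open>Holds at every point, because the default value in \<open>tangent_plane\<close> is a
  plane as well.\<close>

lemma plane2_tangent_plane: "plane2 (tangent_plane \<mu> x)"
proof (cases "\<exists>P. is_approx_tangent_plane \<mu> x P")
  case True
  then have "is_approx_tangent_plane \<mu> x (tangent_plane \<mu> x)"
    unfolding tangent_plane_def by (simp add: someI_ex)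
  then show ?thesis by (simp add: is_approx_tangent_plane_def)
next
  case False
  have "\<exists>P. plane2 P"
    using choose_subspace_of_subspace[of 2 "UNIV :: (real^3) set"] unfolding plane2_def by (auto simp: dim_UNIV)
  then have "plane2 (SOME P. plane2 P)" by (rule someI_ex)
  with False show ?thesis by (simp add: tangent_plane_def)
qed

text \<open>Sums over the chosen bases are not visibly measurable. Completeness lets them inherit
  measurability from an almost everywhere equal function.\<close>

lemma (in complete_measure) measurable_cong_AE:
  assumes f: "f \<in> M \<rightarrow>\<^sub>M N" and ae: "AE x in M. f x = g x" and g: "g \<in> space M \<rightarrow> space N"
  shows "g \<in> M \<rightarrow>\<^sub>M N"
proof (rule measurableI)
  fix A assume A: "A \<in> sets N"
  show "g -` A \<inter> space M \<in> sets M"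
  proof (rule in_sets_AE)
    show "f -` A \<inter> space M \<in> sets M" using f A by (rule measurable_sets)
    show "AE x in M. x \<in> f -` A \<inter> space M \<longleftrightarrow> x \<in> g -` A \<inter> space M"
      using ae by eventually_elim auto
  qed auto
qed (use g in auto)

section \<open>First variation\<close>

locale varifold_in_ball =
  fixes \<mu> :: "(real^3) measure" and H :: "real^3 \<Rightarrow> real^3"
  assumes finite_mu: "finite_measure \<mu>" and sets_mu: "sets \<mu> = sets borel"
    and ball: "AE x in \<mu>. norm x \<le> 1" and curvature: "weak_mean_curvature_L2 \<mu> H"
begin

abbreviation "M \<equiv> completion \<mu>"

sublocale finite_measure \<mu> by (rule finite_mu)

abbreviation "basis_at x \<equiv> plane_basis (tangent_plane \<mu> x)"

lemmas basis_at = plane_basis[OF plane2_tangent_plane[of \<mu>]]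
lemmas basis_at_trace = plane_basis_trace[OF plane2_tangent_plane[of \<mu>]]

lemma space_mu: "space \<mu> = UNIV"
  using sets_eq_imp_space_eq[OF sets_mu] by simp

lemma finite_M: "finite_measure M"
  by (rule finite_measureI) (simp add: emeasure_finite)

lemma ball_M: "AE x in M. norm x \<le> 1"
  using ball by (rule AE_completion)

lemma continuous_measurable: "continuous_on UNIV f \<Longrightarrow> f \<in> borel_measurable \<mu>"
  using sets_mu borel_measurable_continuous_onI measurable_cong_sets by blast

lemma continuous_integrable:
  fixes f :: "real^3 \<Rightarrow> 'b::{banach, second_countable_topology}"
  assumes "continuous_on UNIV f"
  shows "integrable \<mu> f" "integrable M f" "integral\<^sup>L M f = integral\<^sup>L \<mu> f"
proof -
  show "integrable \<mu> f"
    by (rule finite_borel_integrable[OF finite_mu sets_mu compact_cball[of 0 1]]) (use ball assms in auto)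
  then show "integrable M f" "integral\<^sup>L M f = integral\<^sup>L \<mu> f"
    by (simp_all add: integrable_completion integral_completion)
qed

lemma H_measurable: "H \<in> borel_measurable M"
  and H_sq_integrable: "integrable M (\<lambda>x. (norm (H x))\<^sup>2)"
  using curvature by (auto simp: weak_mean_curvature_L2_def)

lemma inner_integrable:
  assumes "continuous_on UNIV g"
  shows "integrable M (\<lambda>x. H x \<bullet> g x)"
proof (rule Bochner_Integration.integrable_bound)
  show "integrable M (\<lambda>x. (norm (H x))\<^sup>2 + (norm (g x))\<^sup>2)"
    by (intro Bochner_Integration.integrable_add H_sq_integrable continuous_integrable continuous_intros assms)
  show "(\<lambda>x. H x \<bullet> g x) \<in> borel_measurable M"
    using H_measurable measurable_completion[OF continuous_measurable[OF assms]] by (rule borel_measurable_inner)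
  have "\<bar>H x \<bullet> g x\<bar> \<le> (norm (H x))\<^sup>2 + (norm (g x))\<^sup>2" for x
  proof -
    have "\<bar>H x \<bullet> g x\<bar> \<le> norm (H x) * norm (g x)" by (rule Cauchy_Schwarz_ineq2)
    also have "\<dots> \<le> (norm (H x))\<^sup>2 + (norm (g x))\<^sup>2"
      using sum_squares_bound[of "norm (H x)" "norm (g x)"] mult_nonneg_nonneg[OF norm_ge_zero[of "H x"] norm_ge_zero[of "g x"]]
      by linarith
    finally show ?thesis .
  qed
  then show "AE x in M. norm (H x \<bullet> g x) \<le> norm ((norm (H x))\<^sup>2 + (norm (g x))\<^sup>2)" by simp
qed

text \<open>Removes compact support from the test fields: multiplying by \<open>cutoff\<close>
  changes neither the field nor its derivative on the unit ball, where almost all of the measure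
  sits.\<close>

lemma first_variation:
  assumes \<eta>: "C1_deriv \<eta> \<eta>'"
  shows "has_bochner_integral M (\<lambda>x. \<Sum>b\<in>basis_at x. \<eta>' x b \<bullet> b) (- (\<integral>x. H x \<bullet> \<eta> x \<partial>M))"
proof -
  have c: "continuous_on UNIV \<eta>" by (rule C1_derivD(3)[OF \<eta>])
  obtain c' where c': "C1_deriv (cutoff :: real^3 \<Rightarrow> real) c'" using C1_deriv_cutoff by blast
  have cc: "continuous_on UNIV (\<lambda>x. cutoff x *\<^sub>R \<eta> x)" by (rule C1_derivD(3)[OF C1_deriv_scaleR[OF c' \<eta>]])
  have *: "has_bochner_integral M (\<lambda>x. div_along (tangent_plane \<mu> x) (\<lambda>x. cutoff x *\<^sub>R \<eta> x) x)
      (- (\<integral>x. H x \<bullet> cutoff x *\<^sub>R \<eta> x \<partial>M))"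
    using curvature C1_compact_support_cutoff[OF \<eta>] by (auto simp: weak_mean_curvature_L2_def)
  have ae: "AE x in M. div_along (tangent_plane \<mu> x) (\<lambda>x. cutoff x *\<^sub>R \<eta> x) x = (\<Sum>b\<in>basis_at x. \<eta>' x b \<bullet> b)"
    using ball_M
  proof eventually_elim
    case (elim x)
    then show ?case
      by (simp add: div_along_def plane_basis_def frechet_derivative_cutoff[OF \<eta>])
  qed
  have eq: "(\<integral>x. H x \<bullet> cutoff x *\<^sub>R \<eta> x \<partial>M) = (\<integral>x. H x \<bullet> \<eta> x \<partial>M)"
  proof (rule integral_cong_AE)
    show "AE x in M. H x \<bullet> cutoff x *\<^sub>R \<eta> x = H x \<bullet> \<eta> x"
      using ball_M
    proof eventually_elim
      case (elim x)
      then have "x \<bullet> x \<le> 2" by (simp add: dot_square_norm power_le_one order_trans[of _ 1])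
      then show ?case by (simp add: cutoff_eq_1)
    qed
  qed (use inner_integrable[OF c] inner_integrable[OF cc] in auto)
  \<comment> \<open>Measurability comes from the Bochner integral in the definition of weak mean
    curvature, applied to the cut-off field.\<close>
  have "(\<lambda>x. \<Sum>b\<in>basis_at x. \<eta>' x b \<bullet> b) \<in> borel_measurable M"
    by (rule completion.measurable_cong_AE[OF borel_measurable_has_bochner_integral[OF *] ae]) auto
  from has_bochner_integralI_AE[OF * this ae] show ?thesis
    unfolding eq .
qed

section \<open>The inequality and its equality case\<close>

lemma mass_identity: "- (\<integral>x. H x \<bullet> x \<partial>M) = 2 * measure \<mu> UNIV"
proof -
  have "has_bochner_integral M (\<lambda>x. 2 :: real) (- (\<integral>x. H x \<bullet> x \<partial>M))"
    using first_variation[OF C1_deriv_bounded_linear[OF bounded_linear_ident]] by (simp add: basis_at_trace)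
  then show ?thesis
    by (auto dest!: has_bochner_integral_integral_eq simp: space_mu sets_mu mult.commute)
qed

lemma integral_sq_identity:
  "integrable M (\<lambda>x. (norm (H x + 2 *\<^sub>R x))\<^sup>2)"
  "(\<integral>x. (norm (H x + 2 *\<^sub>R x))\<^sup>2 \<partial>M) = (\<integral>x. (norm (H x))\<^sup>2 \<partial>M) - 8 * measure \<mu> UNIV + 4 * (\<integral>x. (norm x)\<^sup>2 \<partial>M)"
proof -
  have eq: "(norm (H x + 2 *\<^sub>R x))\<^sup>2 = (norm (H x))\<^sup>2 + 4 * (H x \<bullet> x) + 4 * (norm x)\<^sup>2" for x
    unfolding power2_norm_eq_inner by (simp add: inner_add_left inner_add_right inner_commute)
  have i: "integrable M (\<lambda>x. H x \<bullet> x)" "integrable M (\<lambda>x::real^3. (norm x)\<^sup>2)"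
    by (intro inner_integrable continuous_integrable continuous_intros)+
  show "integrable M (\<lambda>x. (norm (H x + 2 *\<^sub>R x))\<^sup>2)"
    unfolding eq using i H_sq_integrable by auto
  show "(\<integral>x. (norm (H x + 2 *\<^sub>R x))\<^sup>2 \<partial>M) = (\<integral>x. (norm (H x))\<^sup>2 \<partial>M) - 8 * measure \<mu> UNIV + 4 * (\<integral>x. (norm x)\<^sup>2 \<partial>M)"
    unfolding eq using i H_sq_integrable mass_identity by simp
qed

text \<open>Integrate \<open>1 - |x|^2\<close>, which is nonnegative almost everywhere; it vanishes
  almost everywhere as soon as its integral does.\<close>

lemma integral_norm_sq_le: "(\<integral>x. (norm x)\<^sup>2 \<partial>M) \<le> measure \<mu> UNIV"
  and integral_norm_sq_eqD: "(\<integral>x. (norm x)\<^sup>2 \<partial>M) = measure \<mu> UNIV \<Longrightarrow> AE x in M. norm x = 1"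
proof -
  interpret M: finite_measure M by (rule finite_M)
  have i: "integrable M (\<lambda>x::real^3. (norm x)\<^sup>2)"
    by (intro continuous_integrable continuous_intros)
  have nonneg: "AE x in M. 0 \<le> 1 - (norm x)\<^sup>2"
    using ball_M by eventually_elim (simp add: power_le_one)
  have eq: "(\<integral>x. 1 - (norm x)\<^sup>2 \<partial>M) = measure \<mu> UNIV - (\<integral>x. (norm x)\<^sup>2 \<partial>M)"
    using i by (simp add: space_mu sets_mu)
  show "(\<integral>x. (norm x)\<^sup>2 \<partial>M) \<le> measure \<mu> UNIV"
    using integral_nonneg_AE[OF nonneg] eq by simp
  assume "(\<integral>x. (norm x)\<^sup>2 \<partial>M) = measure \<mu> UNIV"
  then have "AE x in M. 1 - (norm x)\<^sup>2 = 0"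
    using integral_nonneg_eq_0_iff_AE[OF _ nonneg] i eq by simp
  then show "AE x in M. norm x = 1"
    by eventually_elim (simp add: abs_square_eq_1)
qed

lemma curvature_lower_bound: "4 * measure \<mu> UNIV \<le> (\<integral>x. (norm (H x))\<^sup>2 \<partial>M)"
proof -
  have "0 \<le> (\<integral>x. (norm (H x + 2 *\<^sub>R x))\<^sup>2 \<partial>M)" by simp
  then show ?thesis using integral_sq_identity(2) integral_norm_sq_le by linarith
qed

text \<open>The defect \<open>\<integral> |H|^2 - 4 \<mu>(UNIV)\<close> is the sum of
  \<open>\<integral> |H + 2 x|^2\<close> and \<open>4 \<integral> (1 - |x|^2)\<close>. Both are
  nonnegative, so both vanish.\<close>

lemma curvature_equalityD:
  assumes "(\<integral>x. (norm (H x))\<^sup>2 \<partial>M) = 4 * measure \<mu> UNIV"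
  shows "AE x in M. norm x = 1" "AE x in M. H x = - 2 *\<^sub>R x"
proof -
  have nn: "0 \<le> (\<integral>x. (norm (H x + 2 *\<^sub>R x))\<^sup>2 \<partial>M)" by simp
  then have eq: "(\<integral>x. (norm x)\<^sup>2 \<partial>M) = measure \<mu> UNIV"
    using integral_sq_identity(2) integral_norm_sq_le assms by linarith
  then show "AE x in M. norm x = 1" by (rule integral_norm_sq_eqD)
  have "(\<integral>x. (norm (H x + 2 *\<^sub>R x))\<^sup>2 \<partial>M) = 0"
    using integral_sq_identity(2) assms eq by simp
  then have "AE x in M. (norm (H x + 2 *\<^sub>R x))\<^sup>2 = 0"
    using integral_nonneg_eq_0_iff_AE[OF integral_sq_identity(1)] by simp
  then show "AE x in M. H x = - 2 *\<^sub>R x"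
    by eventually_elim (simp add: eq_neg_iff_add_eq_0)
qed

text \<open>Replaces \<open>g\<close> by a Borel representative \<open>g'\<close> and transfers the
  statement for Borel measures back to the completion.\<close>

lemma AE_eq_0_if_polynomial_integrals_0_completion:
  fixes g :: "real^3 \<Rightarrow> real"
  assumes g: "integrable M g" and 0: "\<And>p. real_polynomial_function p \<Longrightarrow> (\<integral>x. p x * g x \<partial>M) = 0"
  shows "AE x in M. g x = 0"
proof -
  obtain g' where g'[measurable]: "g' \<in> borel_measurable \<mu>" and ae: "AE x in \<mu>. g x = g' x"
    using completion_ex_borel_measurable_real[OF borel_measurable_integrable[OF g]] by blast
  have ae': "AE x in M. g x = g' x" using ae by (rule AE_completion)
  have g'M: "g' \<in> borel_measurable M" using g' by (rule measurable_completion)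
  have "integrable M g'"
    using integrable_cong_AE_imp[OF g g'M] ae' by (simp add: eq_commute)
  then have i: "integrable \<mu> g'" by (simp add: integrable_completion)
  have "AE x in \<mu>. g' x = 0"
  proof (rule AE_eq_0_if_polynomial_integrals_0[OF finite_mu sets_mu _ compact_cball[of 0 1] i])
    show "AE x in \<mu>. x \<in> cball 0 1" using ball by simp
    fix p :: "real^3 \<Rightarrow> real" assume p: "real_polynomial_function p"
    then have [measurable]: "p \<in> borel_measurable \<mu>"
      using continuous_on_polymonial_function real_polynomial_function_eq by (intro continuous_measurable) blast
    have pM: "p \<in> borel_measurable M" by (rule measurable_completion) measurable
    have "(\<integral>x. p x * g' x \<partial>\<mu>) = (\<integral>x. p x * g' x \<partial>M)"
      by (rule integral_completion[symmetric]) measurable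
    also have "\<dots> = (\<integral>x. p x * g x \<partial>M)"
      by (rule integral_cong_AE) (use ae' g g'M pM in auto)
    finally show "(\<integral>x. p x * g' x \<partial>\<mu>) = 0" using 0[OF p] by simp
  qed
  then have "AE x in M. g' x = 0" by (rule AE_completion)
  with ae' show ?thesis by eventually_elim simp
qed

end

section \<open>Measures carried by the unit sphere\<close>

locale varifold_in_sphere = varifold_in_ball +
  assumes sphere: "AE x in \<mu>. norm x = 1"
begin

lemma sphere_M: "AE x in M. norm x = 1"
  using sphere by (rule AE_completion)

lemma tangent_plane_orthogonal: "AE x in M. \<forall>b\<in>basis_at x. x \<bullet> b = 0"
proof -
  have C: "C1_deriv (\<lambda>x::real^3. (x \<bullet> x - 1) *\<^sub>R x) (\<lambda>x v. (x \<bullet> x - 1) *\<^sub>R v + (2 * (x \<bullet> v)) *\<^sub>R x)"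
    using C1_deriv_scaleR[OF C1_deriv_add[OF C1_deriv_norm_sq C1_deriv_const[of "-1"]] C1_deriv_bounded_linear[OF bounded_linear_ident]]
    by simp
  have c: "continuous_on UNIV (\<lambda>x::real^3. (x \<bullet> x - 1) *\<^sub>R x)" by (intro continuous_intros)
  note fv = first_variation[OF C]
  \<comment> \<open>The field vanishes on the sphere, so the curvature term drops out; its
    divergence there is a sum of squares and must vanish almost everywhere.\<close>
  have "(\<integral>x. H x \<bullet> (x \<bullet> x - 1) *\<^sub>R x \<partial>M) = (\<integral>x. 0 \<partial>M)"
    using sphere_M inner_integrable[OF c] by (intro integral_cong_AE) (auto simp: dot_square_norm)
  moreover have ae: "AE x in M. (\<Sum>b\<in>basis_at x. ((x \<bullet> x - 1) *\<^sub>R b + (2 * (x \<bullet> b)) *\<^sub>R x) \<bullet> b) = 2 * (\<Sum>b\<in>basis_at x. (x \<bullet> b)\<^sup>2)"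
    using sphere_M
    by eventually_elim (simp add: dot_square_norm sum_distrib_left power2_eq_square mult.assoc)
  ultimately have "has_bochner_integral M (\<lambda>x. 2 * (\<Sum>b\<in>basis_at x. (x \<bullet> b)\<^sup>2)) 0"
    using has_bochner_integralI_AE[OF fv _ ae] completion.measurable_cong_AE[OF _ ae] fv by auto
  then have "AE x in M. 2 * (\<Sum>b\<in>basis_at x. (x \<bullet> b)\<^sup>2) = 0"
    using integral_nonneg_eq_0_iff_AE[of M "\<lambda>x. 2 * (\<Sum>b\<in>basis_at x. (x \<bullet> b)\<^sup>2)"]
    by (auto simp: has_bochner_integral_iff sum_nonneg)
  then show ?thesis
  proof eventually_elim
    case (elim x)
    then show ?case using basis_at(4)[of x] by (simp add: sum_nonneg_eq_0_iff)
  qed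
qed

text \<open>The tangent plane is contained in the orthogonal complement of \<open>x\<close>, and
  both have dimension 2.\<close>

lemma tangent_plane_eq: "AE x in M. tangent_plane \<mu> x = {y. x \<bullet> y = 0}"
  using tangent_plane_orthogonal sphere_M
proof eventually_elim
  case (elim x)
  have "tangent_plane \<mu> x \<subseteq> {y. x \<bullet> y = 0}"
    using span_minimal[OF _ subspace_hyperplane, of "basis_at x" x] elim(1) basis_at(3)[of x] by auto
  moreover have "dim {y. x \<bullet> y = 0} = 2" using elim(2) by (subst dim_hyperplane) auto
  ultimately show ?case
    using plane2_tangent_plane[of \<mu> x] subspace_hyperplane[of x]
    by (intro subspace_dim_equal) (auto simp: plane2_def)
qed

text \<open>Test with \<open>f x *\<^sub>R rot_gen u v x\<close>. The generator has zero trace by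
  antisymmetry; and since \<open>rot_gen u v x\<close> lies in the tangent plane, expanding it in
  the orthonormal basis reassembles the full derivative of \<open>f\<close> in that
  direction.\<close>

lemma first_variation_tangential:
  fixes f :: "real^3 \<Rightarrow> real"
  assumes f: "C1_deriv f f'"
  shows "(\<integral>x. f' x (rot_gen u v x) \<partial>\<mu>) = - (\<integral>x. f x * (H x \<bullet> rot_gen u v x) \<partial>M)"
proof -
  note C = C1_deriv_scaleR[OF f C1_deriv_bounded_linear[OF bounded_linear_rot_gen[of u v]]]
  note fv = first_variation[OF C]
  have c: "continuous_on UNIV (\<lambda>x. f' x (rot_gen u v x))"
    by (intro C1_deriv_continuous_apply[OF f] continuous_on_id linear_continuous_on bounded_linear_rot_gen)
  have ae: "AE x in M. (\<Sum>b\<in>basis_at x. (f x *\<^sub>R rot_gen u v b + f' x b *\<^sub>R rot_gen u v x) \<bullet> b) = f' x (rot_gen u v x)"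
    using tangent_plane_eq
  proof eventually_elim
    case (elim x)
    interpret bounded_linear "f' x" by (rule C1_derivD(4)[OF f])
    have "rot_gen u v x \<in> span (basis_at x)"
      using basis_at(3)[of x] elim rot_gen_self[of u v x] by (simp add: inner_commute)
    then have "(\<Sum>b\<in>basis_at x. (rot_gen u v x \<bullet> b) *\<^sub>R b) = rot_gen u v x"
      by (intro orthonormal_basis_expand basis_at)
    then have "f' x (rot_gen u v x) = (\<Sum>b\<in>basis_at x. (rot_gen u v x \<bullet> b) *\<^sub>R f' x b)"
      by (metis (no_types, lifting) scaleR sum sum.cong)
    then show ?case
      by (simp add: inner_add_left rot_gen_self mult.commute)
  qed
  have "has_bochner_integral M (\<lambda>x. f' x (rot_gen u v x)) (- (\<integral>x. H x \<bullet> f x *\<^sub>R rot_gen u v x \<partial>M))"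
    by (rule has_bochner_integralI_AE[OF fv _ ae]) (use continuous_integrable(2)[OF c] in auto)
  then show ?thesis
    using continuous_integrable(3)[OF c] by (simp add: has_bochner_integral_iff)
qed

text \<open>Test with \<open>f x *\<^sub>R x\<close>. Derivatives of \<open>f\<close> are multiplied
  by \<open>x \<bullet> b = 0\<close>, so only the trace 2 remains. This determines the normal
  component of \<open>H\<close>.\<close>

lemma first_variation_radial:
  fixes f :: "real^3 \<Rightarrow> real"
  assumes f: "C1_deriv f f'"
  shows "2 * (\<integral>x. f x \<partial>\<mu>) = - (\<integral>x. f x * (H x \<bullet> x) \<partial>M)"
proof -
  note C = C1_deriv_scaleR[OF f C1_deriv_bounded_linear[OF bounded_linear_ident]]
  note fv = first_variation[OF C]
  have c: "continuous_on UNIV (\<lambda>x. 2 * f x)"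
    by (intro continuous_intros C1_derivD(3)[OF f])
  have ae: "AE x in M. (\<Sum>b\<in>basis_at x. (f x *\<^sub>R b + f' x b *\<^sub>R x) \<bullet> b) = 2 * f x"
    using tangent_plane_orthogonal
  proof eventually_elim
    case (elim x)
    then show ?case
      using basis_at_trace[of x] by (simp add: inner_add_left flip: sum_distrib_left)
  qed
  have "has_bochner_integral M (\<lambda>x. 2 * f x) (- (\<integral>x. H x \<bullet> f x *\<^sub>R x \<partial>M))"
    by (rule has_bochner_integralI_AE[OF fv _ ae]) (use continuous_integrable(2)[OF c] in auto)
  then show ?thesis
    using continuous_integrable(3)[OF c] by (simp add: has_bochner_integral_iff)
qed

text \<open>A radial \<open>H\<close> is orthogonal to \<open>rot_gen u v x\<close>, so the
  right-hand side of \<open>first_variation_tangential\<close> vanishes.\<close>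

lemma rotation_invariant_if_curvature:
  assumes H: "AE x in M. H x = - 2 *\<^sub>R x" and uv: "norm u = 1" "norm v = 1" "u \<bullet> v = 0"
  shows "distr \<mu> borel (rotation u v t) = \<mu>"
proof -
  have "(\<integral>x. f' x (rot_gen u v x) \<partial>\<mu>) = 0" if f: "C1_deriv f f'" for f :: "real^3 \<Rightarrow> real" and f'
  proof -
    have "AE x in M. f x * (H x \<bullet> rot_gen u v x) = 0"
      using H by eventually_elim (simp add: inner_commute[of _ "rot_gen _ _ _"] rot_gen_self)
    then have "(\<integral>x. f x * (H x \<bullet> rot_gen u v x) \<partial>M) = 0"
      by (rule integral_eq_zero_AE)
    then show ?thesis using first_variation_tangential[OF f] by simp
  qed
  then show ?thesis
    using rotation_invariant_iff[OF finite_mu sets_mu ball uv] by blast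
qed

text \<open>Invariance makes every \<open>H x \<bullet> rot_gen u v x\<close> integrate to 0 against
  polynomials, which leaves \<open>H\<close> radial; the radial first variation gives
  \<open>H x \<bullet> x = - 2\<close>. Coordinate rotations suffice.\<close>

lemma curvature_if_rotation_invariant:
  assumes inv: "\<And>u v t. norm u = 1 \<Longrightarrow> norm v = 1 \<Longrightarrow> u \<bullet> v = 0 \<Longrightarrow> distr \<mu> borel (rotation u v t) = \<mu>"
  shows "AE x in M. H x = - 2 *\<^sub>R x"
proof -
  have tang: "AE x in M. H x \<bullet> rot_gen u v x = 0" if "u \<in> Basis" "v \<in> Basis" for u v
  proof (cases "u = v")
    case True then show ?thesis by (simp add: rot_gen_def)
  next
    case False
    then have uv: "norm u = 1" "norm v = 1" "u \<bullet> v = 0" using that by (auto simp: inner_Basis)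
    show ?thesis
    proof (rule AE_eq_0_if_polynomial_integrals_0_completion)
      show "integrable M (\<lambda>x. H x \<bullet> rot_gen u v x)"
        by (intro inner_integrable linear_continuous_on bounded_linear_rot_gen)
      fix p :: "real^3 \<Rightarrow> real" assume "real_polynomial_function p"
      then obtain p' where p: "C1_deriv p p'" using real_polynomial_function_C1 by blast
      have "(\<integral>x. p' x (rot_gen u v x) \<partial>\<mu>) = 0"
        using rotation_invariant_iff[OF finite_mu sets_mu ball uv] inv[OF uv] p by blast
      then show "(\<integral>x. p x * (H x \<bullet> rot_gen u v x) \<partial>M) = 0"
        using first_variation_tangential[OF p, of u v] by simp
    qed
  qed
  have "AE x in M. \<forall>u\<in>Basis. \<forall>v\<in>Basis. H x \<bullet> rot_gen u v x = 0"
    by (intro AE_finite_allI tang) auto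
  moreover have "AE x in M. H x \<bullet> x + 2 = 0"
  proof (rule AE_eq_0_if_polynomial_integrals_0_completion)
    interpret M: finite_measure M by (rule finite_M)
    have i: "integrable M (\<lambda>x. H x \<bullet> x)" by (intro inner_integrable continuous_intros)
    then show "integrable M (\<lambda>x. H x \<bullet> x + 2)" by simp
    fix p :: "real^3 \<Rightarrow> real" assume "real_polynomial_function p"
    then obtain p' where p: "C1_deriv p p'" using real_polynomial_function_C1 by blast
    have c: "continuous_on UNIV p" by (rule C1_derivD(3)[OF p])
    have "integrable M (\<lambda>x. H x \<bullet> (p x *\<^sub>R x))"
      by (intro inner_integrable continuous_intros c)
    then have "(\<integral>x. p x * (H x \<bullet> x + 2) \<partial>M) = (\<integral>x. p x * (H x \<bullet> x) \<partial>M) + 2 * (\<integral>x. p x \<partial>M)"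
      using continuous_integrable(2)[OF c] by (simp add: distrib_left)
    then show "(\<integral>x. p x * (H x \<bullet> x + 2) \<partial>M) = 0"
      using first_variation_radial[OF p] continuous_integrable(3)[OF c] by simp
  qed
  ultimately show ?thesis using sphere_M
  proof eventually_elim
    case (elim x)
    \<comment> \<open>The two by two minors of \<open>x\<close> and \<open>H x\<close> vanish, that
      is, the vectors are parallel.\<close>
    have sw: "(x \<bullet> i) * (H x \<bullet> j) = (x \<bullet> j) * (H x \<bullet> i)" if "i \<in> Basis" "j \<in> Basis" for i j
    proof -
      have "H x \<bullet> rot_gen i j x = 0" using elim(1) that by blast
      then show ?thesis by (simp add: rot_gen_def inner_diff_right inner_commute)
    qed
    show ?case
    proof (rule euclidean_eqI)
      fix j :: "real^3" assume j: "j \<in> Basis"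
      \<comment> \<open>Inserting the factor \<open>x \<bullet> x = 1\<close> and exchanging indices
        by \<open>sw\<close> produces \<open>(H x \<bullet> x) * (x \<bullet> j)\<close>.\<close>
      have "H x \<bullet> j = (\<Sum>i\<in>Basis. (x \<bullet> i) * (x \<bullet> i)) * (H x \<bullet> j)"
        using elim(3) by (simp add: euclidean_inner[of x x, symmetric] dot_square_norm)
      also have "\<dots> = (\<Sum>i\<in>Basis. (x \<bullet> i) * ((x \<bullet> i) * (H x \<bullet> j)))"
        by (simp add: sum_distrib_right mult.assoc)
      also have "\<dots> = (\<Sum>i\<in>Basis. (x \<bullet> i) * ((x \<bullet> j) * (H x \<bullet> i)))"
        by (intro sum.cong) (simp_all add: sw[OF _ j])
      also have "\<dots> = (\<Sum>i\<in>Basis. (H x \<bullet> i) * (x \<bullet> i)) * (x \<bullet> j)"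
        by (simp add: sum_distrib_right sum_distrib_left mult_ac)
      also have "\<dots> = (- 2 *\<^sub>R x) \<bullet> j"
        using elim(2) by (simp add: euclidean_inner[of "H x" x, symmetric] add_eq_0_iff2)
      finally show "H x \<bullet> j = (- 2 *\<^sub>R x) \<bullet> j" .
    qed
  qed
qed

lemma curvature_integral:
  assumes H: "AE x in M. H x = - 2 *\<^sub>R x"
  shows "(\<integral>x. (norm (H x))\<^sup>2 \<partial>M) = 4 * measure \<mu> UNIV"
proof -
  have "(\<integral>x. (norm (H x))\<^sup>2 \<partial>M) = (\<integral>x. 4 \<partial>M)"
  proof (rule integral_cong_AE)
    show "AE x in M. (norm (H x))\<^sup>2 = 4"
      using H sphere_M by eventually_elim (simp add: power_mult_distrib)
  qed (use H_sq_integrable in auto)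
  then show ?thesis by (simp add: space_mu sets_mu)
qed

end

section \<open>Hausdorff measure of the sphere\<close>

lemma diameter_isometric_image:
  assumes "\<And>x y. dist (R x) (R y) = dist x y"
  shows "diameter (R ` U) = diameter U"
proof -
  have "(\<lambda>(x, y). dist x y) ` (R ` U \<times> R ` U) = (\<lambda>(x, y). dist x y) ` (U \<times> U)"
    using assms by (force simp: image_iff)
  then show ?thesis by (simp add: diameter_def)
qed

text \<open>Images of a covering form a covering with the same diameters. One inequality suffices,
  since it can also be applied to an inverse isometry.\<close>

lemma hausdorff2_outer_isometric_image_le:
  fixes R :: "'a::metric_space \<Rightarrow> 'b::metric_space"
  assumes R: "\<And>x y. dist (R x) (R y) = dist x y"
  shows "hausdorff2_outer (R ` A) \<le> hausdorff2_outer A"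
  unfolding hausdorff2_outer_def
proof (rule SUP_mono')
  fix \<delta> :: real
  show "hausdorff2_pre \<delta> (R ` A) \<le> hausdorff2_pre \<delta> A"
    unfolding hausdorff2_pre_def
  proof (rule INF_greatest)
    fix U :: "nat \<Rightarrow> 'a set"
    assume U: "U \<in> {U. A \<subseteq> (\<Union>i. U i) \<and> (\<forall>i. bounded (U i) \<and> diameter (U i) \<le> \<delta>)}"
    have b: "bounded (R ` U i)" for i
    proof -
      obtain x e where "\<forall>y\<in>U i. dist x y \<le> e" using U unfolding bounded_def by blast
      then have "\<forall>y\<in>R ` U i. dist (R x) y \<le> e" using R by auto
      then show ?thesis unfolding bounded_def by blast
    qed
    have "R ` A \<subseteq> (\<Union>i. R ` U i)" using U by blast
    with U b show "(INF U \<in> {U. R ` A \<subseteq> (\<Union>i. U i) \<and> (\<forall>i. bounded (U i) \<and> diameter (U i) \<le> \<delta>)}.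
         \<Sum>i. ennreal (pi * (diameter (U i) / 2)\<^sup>2)) \<le> (\<Sum>i. ennreal (pi * (diameter (U i) / 2)\<^sup>2))"
      by (intro INF_lower2[where i = "\<lambda>i. R ` U i"]) (auto simp: diameter_isometric_image[OF R])
  qed
qed

lemma sets_hausdorff2 [simp, measurable_cong]: "sets (hausdorff2 :: 'a::metric_space measure) = sets borel"
  using sets.sets_measure_of_eq[of "borel :: 'a::metric_space measure"]
  by (simp add: hausdorff2_def sets_measure_of_conv)

text \<open>\<^const>\<open>measure_of\<close> returns the zero measure unless its argument is countably additive on
  the generated sigma-algebra. The case distinction makes it unnecessary to prove that
  \<^const>\<open>hausdorff2_outer\<close> is additive on Borel sets.\<close>

lemma emeasure_hausdorff2:
  "(\<forall>A\<in>sets borel. emeasure hausdorff2 A = hausdorff2_outer (A :: 'a::metric_space set)) \<or>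
   (\<forall>A. emeasure hausdorff2 (A :: 'a set) = 0)"
proof (cases "measure_space UNIV (sigma_sets UNIV (sets borel)) (hausdorff2_outer :: 'a set \<Rightarrow> ennreal)")
  case True
  then have "emeasure hausdorff2 A = hausdorff2_outer A" if "A \<in> sets borel" for A :: "'a set"
    using that sets.sigma_sets_eq[of "borel :: 'a measure"]
    by (simp add: hausdorff2_def emeasure_measure_of_conv)
  then show ?thesis by blast
next
  case False
  then show ?thesis by (simp add: hausdorff2_def emeasure_measure_of_conv)
qed

text \<open>The preimage of a set is its image under the inverse rotation, to which the isometry
  bound applies both ways. Either alternative of \<open>emeasure_hausdorff2\<close> then gives
  invariance.\<close>

lemma distr_rotation_hausdorff2:
  assumes uv: "norm u = 1" "norm v = 1" "u \<bullet> v = 0"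
  shows "distr hausdorff2 borel (rotation u v t) = hausdorff2"
proof (rule measure_eqI)
  have [measurable]: "rotation u v t \<in> borel_measurable hausdorff2"
    using measurable_rotation measurable_cong_sets[OF sets_hausdorff2 refl] by blast
  fix A :: "'a set" assume "A \<in> sets (distr hausdorff2 borel (rotation u v t))"
  then have A: "A \<in> sets borel" by simp
  have sp: "space hausdorff2 = (UNIV :: 'a set)" by (simp add: hausdorff2_def space_measure_of_conv)
  have inv: "rotation u v t (rotation u v (- t) x) = x" for x using rotation_inverse[OF uv, of "- t"] by simp
  have vi: "rotation u v t -` A = rotation u v (- t) ` A"
  proof safe
    fix x assume "rotation u v t x \<in> A"
    then show "x \<in> rotation u v (- t) ` A"
      using rotation_inverse[OF uv, of t x] by (metis image_eqI)
  qed (simp add: inv)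
  have "hausdorff2_outer (rotation u v (- t) ` A) = hausdorff2_outer A"
  proof (rule antisym)
    show "hausdorff2_outer (rotation u v (- t) ` A) \<le> hausdorff2_outer A"
      by (rule hausdorff2_outer_isometric_image_le) (rule dist_rotation[OF uv])
    have "hausdorff2_outer (rotation u v t ` rotation u v (- t) ` A) \<le> hausdorff2_outer (rotation u v (- t) ` A)"
      by (rule hausdorff2_outer_isometric_image_le) (rule dist_rotation[OF uv])
    then show "hausdorff2_outer A \<le> hausdorff2_outer (rotation u v (- t) ` A)"
      by (simp add: image_comp comp_def inv)
  qed
  moreover have "rotation u v t -` A \<in> sets borel"
    using measurable_sets[OF measurable_rotation A, of u v t] by simp
  ultimately have "emeasure hausdorff2 (rotation u v t -` A) = emeasure hausdorff2 A"
    using emeasure_hausdorff2[where 'a = 'a] A vi by metis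
  then show "emeasure (distr hausdorff2 borel (rotation u v t)) A = emeasure hausdorff2 A"
    using A by (subst emeasure_distr) (auto simp: sp)
qed simp

section \<open>Finite Hausdorff measure of the sphere\<close>

lemma spherical_coordinates:
  fixes x :: "real^3"
  assumes "norm x = 1"
  obtains s t where "0 \<le> s" "s < 2 * pi" "0 \<le> t" "t < 2 * pi"
    "x = vector [sin s * cos t, sin s * sin t, cos s]"
proof -
  have x: "(x $ 1)\<^sup>2 + (x $ 2)\<^sup>2 + (x $ 3)\<^sup>2 = 1"
  proof -
    have "x \<bullet> x = 1" using assms by (simp add: dot_square_norm)
    then show ?thesis by (simp add: inner_vec_def sum_3 power2_eq_square)
  qed
  define r where "r = sqrt ((x $ 1)\<^sup>2 + (x $ 2)\<^sup>2)"
  have r2: "r\<^sup>2 = (x $ 1)\<^sup>2 + (x $ 2)\<^sup>2" by (simp add: r_def)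
  have "(x $ 3)\<^sup>2 + r\<^sup>2 = 1" using x r2 by simp
  \<comment> \<open>The polar angle is only recorded as less than \<open>2 * pi\<close>; the
    covering below needs no sharper range.\<close>
  then obtain s where s: "0 \<le> s" "s < 2 * pi" "x $ 3 = cos s" "r = sin s"
    by (rule sincos_total_2pi)
  obtain t where t: "0 \<le> t" "t < 2 * pi" "x $ 1 = r * cos t" "x $ 2 = r * sin t"
  proof (cases "r = 0")
    \<comment> \<open>At the poles the longitude is arbitrary, and 0 is taken.\<close>
    case True
    then have "x $ 1 = 0" "x $ 2 = 0" using r2 by (auto simp: sum_power2_eq_zero_iff)
    with True show ?thesis by (intro that[of 0]) auto
  next
    case False
    then have "(x $ 1 / r)\<^sup>2 + (x $ 2 / r)\<^sup>2 = 1"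
      using r2 by (simp add: power_divide flip: add_divide_distrib r2)
    then obtain t where "0 \<le> t" "t < 2 * pi" "x $ 1 / r = cos t" "x $ 2 / r = sin t"
      by (rule sincos_total_2pi)
    with False show ?thesis by (intro that[of t]) (auto simp: field_simps)
  qed
  have "x = vector [sin s * cos t, sin s * sin t, cos s]"
    using s t by (simp add: vec_eq_iff forall_3)
  then show ?thesis using that s t by blast
qed

text \<open>Sine and cosine are 1-Lipschitz and bounded by 1. Each of the two products varies by at
  most the sum of both angle differences, and the last coordinate by
  \<open>\<bar>s - s'\<bar>\<close>.\<close>

lemma dist_spherical_coordinates_le:
  fixes s t s' t' :: real
  shows "dist (vector [sin s * cos t, sin s * sin t, cos s] :: real^3) (vector [sin s' * cos t', sin s' * sin t', cos s'])
     \<le> 3 * \<bar>s - s'\<bar> + 2 * \<bar>t - t'\<bar>"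
proof -
  have sin: "\<bar>sin a - sin b\<bar> \<le> \<bar>a - b\<bar>" for a b :: real
    using field_differentiable_bound[of UNIV sin cos 1 a b] by (auto intro: DERIV_sin)
  have cos: "\<bar>cos a - cos b\<bar> \<le> \<bar>a - b\<bar>" for a b :: real
    using field_differentiable_bound[of UNIV cos "\<lambda>x. - sin x" 1 a b] by (auto intro: DERIV_cos)
  have prod: "\<bar>a * b - c * d\<bar> \<le> \<bar>a - c\<bar> + \<bar>b - d\<bar>" if "\<bar>b\<bar> \<le> 1" "\<bar>c\<bar> \<le> 1" for a b c d :: real
  proof -
    have "a * b - c * d = (a - c) * b + c * (b - d)" by (simp add: algebra_simps)
    then have "\<bar>a * b - c * d\<bar> \<le> \<bar>a - c\<bar> * \<bar>b\<bar> + \<bar>c\<bar> * \<bar>b - d\<bar>" by (metis abs_mult abs_triangle_ineq)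
    also have "\<dots> \<le> \<bar>a - c\<bar> * 1 + 1 * \<bar>b - d\<bar>" using that by (intro add_mono mult_mono) auto
    finally show ?thesis by simp
  qed
  let ?d = "(vector [sin s * cos t, sin s * sin t, cos s] :: real^3) - vector [sin s' * cos t', sin s' * sin t', cos s']"
  have "norm ?d \<le> (\<Sum>i\<in>UNIV. \<bar>?d $ i\<bar>)" by (rule norm_le_l1_cart)
  also have "\<dots> = \<bar>sin s * cos t - sin s' * cos t'\<bar> + \<bar>sin s * sin t - sin s' * sin t'\<bar> + \<bar>cos s - cos s'\<bar>"
    by (simp add: sum_3)
  also have "\<dots> \<le> 3 * \<bar>s - s'\<bar> + 2 * \<bar>t - t'\<bar>"
    using prod[of "cos t" "sin s'" "sin s" "cos t'"] prod[of "sin t" "sin s'" "sin s" "sin t'"]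
      sin[of s s'] sin[of t t'] cos[of t t'] cos[of s s'] by simp
  finally show ?thesis by (simp add: dist_norm)
qed

text \<open>Cut the parameter square into \<open>n * n\<close> cells. Their images have diameter at
  most \<open>40 / n\<close>, so the covering costs at most
  \<open>n * n * pi * (20 / n)^2 = 400 * pi\<close>, whatever \<open>\<delta>\<close> is.\<close>

lemma hausdorff2_outer_sphere_finite: "hausdorff2_outer (sphere 0 1 :: (real^3) set) < \<infinity>"
proof -
  have "hausdorff2_pre \<delta> (sphere 0 1 :: (real^3) set) \<le> ennreal (400 * pi)" if "\<delta> > 0" for \<delta>
  proof -
    obtain n :: nat where n: "n > 0" "40 / real n \<le> \<delta>"
    proof -
      obtain n :: nat where n: "40 / \<delta> < real n" using reals_Archimedean2 by blast
      moreover have "0 < 40 / \<delta>" using \<open>\<delta> > 0\<close> by simp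
      ultimately have "n > 0" using gr0I by fastforce
      with n show ?thesis using \<open>\<delta> > 0\<close> by (intro that[of n]) (auto simp: field_simps)
    qed
    \<comment> \<open>The parameter square has side 8, which exceeds \<open>2 * pi\<close> because
      \<open>pi < 4\<close>; the factor 5 below is the sum of the Lipschitz constants 3 and
      2.\<close>
    define h where "h = 8 / real n"
    have h: "h > 0" "n * h = 8" "5 * h = 40 / n" using n by (auto simp: h_def)
    define F :: "real \<Rightarrow> real \<Rightarrow> real^3" where "F s t = vector [sin s * cos t, sin s * sin t, cos s]" for s t
    \<comment> \<open>Quotient and remainder by \<open>n\<close> give the row and column of a cell.
      All later sets are empty, which turns the series into a finite sum.\<close>
    define U where "U i = (if i < n * n then {F s t |s t. real (i div n) * h \<le> s \<and> s \<le> (real (i div n) + 1) * h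
        \<and> real (i mod n) * h \<le> t \<and> t \<le> (real (i mod n) + 1) * h} else {})" for i
    have dist: "norm (x - y) \<le> 40 / n" if xy: "x \<in> U i" "y \<in> U i" for x y i
    proof -
      obtain s t s' t' where st: "x = F s t" "y = F s' t'"
        "real (i div n) * h \<le> s" "s \<le> (real (i div n) + 1) * h" "real (i mod n) * h \<le> t" "t \<le> (real (i mod n) + 1) * h"
        "real (i div n) * h \<le> s'" "s' \<le> (real (i div n) + 1) * h" "real (i mod n) * h \<le> t'" "t' \<le> (real (i mod n) + 1) * h"
        using xy by (auto simp: U_def split: if_splits)
      have "\<bar>s - s'\<bar> \<le> h" "\<bar>t - t'\<bar> \<le> h" using st by (auto simp: algebra_simps)
      then have "3 * \<bar>s - s'\<bar> + 2 * \<bar>t - t'\<bar> \<le> 3 * h + 2 * h" by (intro add_mono mult_left_mono) auto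
      also have "\<dots> = 40 / n" using h(3) by simp
      finally have "3 * \<bar>s - s'\<bar> + 2 * \<bar>t - t'\<bar> \<le> 40 / n" .
      then show ?thesis
        using dist_spherical_coordinates_le[of s t s' t'] by (simp add: st(1,2) F_def dist_norm)
    qed
    have diam: "diameter (U i) \<le> 40 / n" for i
      by (rule diameter_le) (use dist in auto)
    have bdd: "bounded (U i)" for i
      unfolding bounded_two_points using dist[of _ i] by (auto simp: dist_norm)
    have cover: "sphere 0 1 \<subseteq> (\<Union>i. U i)"
    proof
      fix x :: "real^3" assume "x \<in> sphere 0 1"
      then obtain s t where st: "0 \<le> s" "s < 2 * pi" "0 \<le> t" "t < 2 * pi" "x = F s t"
        using spherical_coordinates[of x] unfolding F_def by auto
      have cell: "\<exists>a<n. real a * h \<le> r \<and> r \<le> (real a + 1) * h" if "0 \<le> r" "r < 2 * pi" for r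
      proof (intro exI conjI)
        let ?a = "nat \<lfloor>r / h\<rfloor>"
        have "r < n * h" using that pi_less_4 h by simp
        then have lt: "r / h < n" using h by (simp add: pos_divide_less_eq)
        have fl: "real ?a = of_int \<lfloor>r / h\<rfloor>" using that h by simp
        have "real ?a \<le> r / h" "r / h \<le> real ?a + 1" unfolding fl by linarith+
        then show "real ?a * h \<le> r" "r \<le> (real ?a + 1) * h"
          using h(1) by (simp_all only: pos_le_divide_eq pos_divide_le_eq)
        have "real ?a < real n" using \<open>real ?a \<le> r / h\<close> lt by (rule order_le_less_trans)
        then show "?a < n" by simp
      qed
      obtain a where a: "a < n" "real a * h \<le> s" "s \<le> (real a + 1) * h" using cell[of s] st by blast
      obtain b where b: "b < n" "real b * h \<le> t" "t \<le> (real b + 1) * h" using cell[of t] st by blast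
      have dm: "(a * n + b) div n = a" "(a * n + b) mod n = b" using b n by auto
      have "a * n + b < n * n"
      proof -
        have "a * n + b < (a + 1) * n" using b by simp
        also have "\<dots> \<le> n * n" using a by (intro mult_right_mono) auto
        finally show ?thesis .
      qed
      then have "x \<in> U (a * n + b)" using a b st(5) by (auto simp: U_def dm)
      then show "x \<in> (\<Union>i. U i)" by blast
    qed
    have "hausdorff2_pre \<delta> (sphere 0 1 :: (real^3) set) \<le> (\<Sum>i. ennreal (pi * (diameter (U i) / 2)\<^sup>2))"
      unfolding hausdorff2_pre_def using cover bdd diam n(2) by (intro INF_lower) (auto intro: order_trans)
    also have "\<dots> = (\<Sum>i<n * n. ennreal (pi * (diameter (U i) / 2)\<^sup>2))"
      by (rule suminf_finite) (auto simp: U_def)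
    also have "\<dots> \<le> (\<Sum>i<n * n. ennreal (pi * (20 / n)\<^sup>2))"
    proof (intro sum_mono ennreal_leI mult_left_mono power_mono)
      fix i
      show "diameter (U i) / 2 \<le> 20 / real n" using diam[of i] by simp
      show "0 \<le> diameter (U i) / 2" using diameter_ge_0[OF bdd] by simp
    qed auto
    also have "\<dots> = ennreal (real (n * n) * (pi * (20 / n)\<^sup>2))"
      by (simp add: ennreal_mult' flip: ennreal_of_nat_eq_real_of_nat)
    also have "real (n * n) * (pi * (20 / n)\<^sup>2) = 400 * pi"
      using n by (simp add: power2_eq_square)
    finally show ?thesis .
  qed
  then have "hausdorff2_outer (sphere 0 1 :: (real^3) set) \<le> ennreal (400 * pi)"
    unfolding hausdorff2_outer_def by (intro SUP_least) auto
  then show ?thesis by (simp add: le_less_trans)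
qed

section \<open>Hausdorff measure restricted to the sphere, and its multiples\<close>

abbreviation sphere_measure :: "(real^3) measure" where
  "sphere_measure \<equiv> measure_restr hausdorff2 (sphere 0 1)"

lemma sets_measure_restr [simp]: "sets (measure_restr N A) = sets N"
  by (simp add: measure_restr_def)

lemma emeasure_measure_restr:
  assumes "A \<in> sets N" "B \<in> sets N"
  shows "emeasure (measure_restr N A) B = emeasure N (A \<inter> B)"
proof -
  have "(\<integral>\<^sup>+x. indicator A x * indicator B x \<partial>N) = (\<integral>\<^sup>+x. indicator (A \<inter> B) x \<partial>N)"
    by (simp add: indicator_inter_arith)
  then show ?thesis using assms by (simp add: measure_restr_def emeasure_density sets.Int)
qed

lemma sphere_borel: "sphere 0 1 \<in> sets (hausdorff2 :: (real^3) measure)"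
  by (simp add: borel_compact)

lemma finite_sphere_measure: "finite_measure sphere_measure"
proof (rule finite_measureI)
  have "emeasure sphere_measure (space sphere_measure) = emeasure hausdorff2 (sphere 0 1 :: (real^3) set)"
    using sets_eq_imp_space_eq[OF sets_hausdorff2[where 'a = "real^3"]] sphere_borel
    by (simp add: emeasure_measure_restr sets_eq_imp_space_eq[of sphere_measure borel])
  also have "\<dots> \<noteq> \<infinity>"
    using emeasure_hausdorff2[where 'a = "real^3"] hausdorff2_outer_sphere_finite sphere_borel
    by (metis infinity_ennreal_def less_irrefl sets_hausdorff2 ennreal_zero_neq_top)
  finally show "emeasure sphere_measure (space sphere_measure) \<noteq> \<infinity>" .
qed

lemma AE_sphere_measure: "AE x in sphere_measure. norm x = 1"
  using sphere_borel unfolding measure_restr_def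
  by (subst AE_density) (auto simp: indicator_def intro!: borel_measurable_indicator)

lemma distr_rotation_sphere_measure:
  fixes u v :: "real^3"
  assumes uv: "norm u = 1" "norm v = 1" "u \<bullet> v = 0"
  shows "distr sphere_measure borel (rotation u v t) = sphere_measure"
proof (rule measure_eqI)
  have R: "rotation u v t \<in> borel_measurable sphere_measure" "rotation u v t \<in> borel_measurable hausdorff2"
    using measurable_rotation by (simp_all cong: measurable_cong_sets)
  have sp: "space sphere_measure = UNIV" "space hausdorff2 = (UNIV :: (real^3) set)"
    by (simp_all add: sets_eq_imp_space_eq[of sphere_measure borel] sets_eq_imp_space_eq[of "hausdorff2 :: (real^3) measure" borel])
  fix A :: "(real^3) set" assume "A \<in> sets (distr sphere_measure borel (rotation u v t))"
  then have A: "A \<in> sets borel" by simp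
  have SA: "sphere 0 1 \<inter> A \<in> sets borel" using A sphere_borel by auto
  have RA: "rotation u v t -` A \<in> sets borel"
    using measurable_sets[OF measurable_rotation A, of u v t] by simp
  have "emeasure (distr sphere_measure borel (rotation u v t)) A = emeasure sphere_measure (rotation u v t -` A)"
    using A R by (subst emeasure_distr) (auto simp: sp)
  also have "\<dots> = emeasure hausdorff2 (sphere 0 1 \<inter> rotation u v t -` A)"
    using RA sphere_borel by (subst emeasure_measure_restr) auto
  also have "sphere 0 1 \<inter> rotation u v t -` A = rotation u v t -` (sphere 0 1 \<inter> A)"
    by (auto simp: norm_rotation[OF uv])
  also have "emeasure hausdorff2 \<dots> = emeasure (distr hausdorff2 borel (rotation u v t)) (sphere 0 1 \<inter> A)"
    using SA R by (subst emeasure_distr) (auto simp: sp)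
  also have "\<dots> = emeasure sphere_measure A"
    using A sphere_borel by (simp add: distr_rotation_hausdorff2[OF uv] emeasure_measure_restr)
  finally show "emeasure (distr sphere_measure borel (rotation u v t)) A = emeasure sphere_measure A" .
qed simp

text \<open>Some rotation takes \<open>x\<close> to \<open>y\<close>, and being an isometry it takes
  the ball about \<open>x\<close> to the ball about \<open>y\<close>.\<close>

lemma rotation_invariant_imp_uniformly_distributed:
  fixes M :: "(real^3) measure"
  assumes M: "sets M = sets borel"
    and inv: "\<And>u v t. norm u = 1 \<Longrightarrow> norm v = 1 \<Longrightarrow> u \<bullet> v = 0 \<Longrightarrow> distr M borel (rotation u v t) = M"
    and xy: "norm x = 1" "norm y = 1"
  shows "measure M (cball x r) = measure M (cball y r)"
proof -
  obtain u v t where uv: "norm u = 1" "norm v = 1" "u \<bullet> v = 0" and t: "rotation u v t x = y"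
    using rotation_transitive[OF xy] by auto
  have R: "rotation u v t \<in> borel_measurable M"
    using measurable_rotation M by (simp cong: measurable_cong_sets)
  have "rotation u v t -` cball y r = cball x r"
    using dist_rotation[OF uv, of t x] by (auto simp: t)
  then have "measure (distr M borel (rotation u v t)) (cball y r) = measure M (cball x r)"
    using R sets_eq_imp_space_eq[OF M] by (subst measure_distr) auto
  then show ?thesis by (simp add: inv[OF uv])
qed

lemma scale_measure_eq_density: "scale_measure c N = density N (\<lambda>_. c)"
  by (rule measure_eqI) (auto simp: emeasure_density nn_integral_cmult)

text \<open>With respect to the sphere measure, \<mu> has both the integer valued density
  \<open>g\<close> and the constant density \<open>c\<close>. Uniqueness of densities makes
  \<open>c\<close> a value of \<open>g\<close>. A null sphere measure forces \<mu> to vanish, and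
  then \<open>k = 0\<close> works.\<close>

lemma proportional_imp_integral_multiple:
  assumes \<mu>: "\<mu> = density hausdorff2 (\<lambda>x. of_nat (\<theta> x) * indicator A x)"
    and A: "A \<in> sets borel" and \<theta>: "\<theta> \<in> borel \<rightarrow>\<^sub>M count_space UNIV"
    and sphere: "AE x in \<mu>. norm x = 1" and multiple: "measure sphere_measure UNIV > 0 \<Longrightarrow> \<mu> = scale_measure c sphere_measure"
  shows "\<exists>k::nat. \<mu> = scale_measure (of_nat k) sphere_measure"
proof -
  define g :: "real^3 \<Rightarrow> ennreal" where "g x = of_nat (\<theta> x) * indicator A x" for x
  have "(\<lambda>x. of_nat (\<theta> x) :: ennreal) \<in> borel_measurable borel"
    using measurable_compose[OF \<theta>, of of_nat borel] by simp
  then have g: "g \<in> borel_measurable borel" unfolding g_def using A by auto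
  then have gh[measurable]: "g \<in> borel_measurable hausdorff2" by (simp cong: measurable_cong_sets)
  have gs: "g \<in> borel_measurable sphere_measure" using g by (simp cong: measurable_cong_sets)
  have \<mu>g: "\<mu> = density hausdorff2 g" by (simp add: \<mu> g_def[abs_def])
  have S[measurable]: "sphere 0 1 \<in> sets (hausdorff2 :: (real^3) measure)" by (rule sphere_borel)
  have "density sphere_measure g = density hausdorff2 (\<lambda>x. indicator (sphere 0 1) x * g x)"
    unfolding measure_restr_def by (rule density_density_eq) measurable
  \<comment> \<open>Restricting to the sphere loses nothing, since \<open>g\<close> vanishes almost
    everywhere off it.\<close>
  also have "\<dots> = density hausdorff2 g"
  proof (rule density_cong)
    have "AE x in hausdorff2. g x > 0 \<longrightarrow> norm x = 1"
      using sphere unfolding \<mu>g by (subst (asm) AE_density) auto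
    then show "AE x in hausdorff2. indicator (sphere 0 1) x * g x = g x"
      by eventually_elim (auto simp: indicator_def zero_less_iff_neq_zero)
  qed measurable
  finally have d: "\<mu> = density sphere_measure g" using \<mu>g by simp
  interpret S: finite_measure sphere_measure by (rule finite_sphere_measure)
  have sp: "space sphere_measure = UNIV"
    by (simp add: sets_eq_imp_space_eq[of sphere_measure borel])
  show ?thesis
  proof (cases "measure sphere_measure UNIV > 0")
    case True
    then have "density sphere_measure g = density sphere_measure (\<lambda>_. c)"
      using multiple d scale_measure_eq_density by metis
    then have ae: "AE x in sphere_measure. g x = c"
      by (rule S.density_unique[OF gs borel_measurable_const])
    \<comment> \<open>An almost everywhere equality yields an actual point because the sphere
      measure is not zero.\<close>
    have "\<exists>x. g x = c"
    proof (rule ccontr)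
      assume "\<nexists>x. g x = c"
      then have "AE x in sphere_measure. False" using ae by simp
      then have "emeasure sphere_measure UNIV = 0"
        using AE_iff_measurable[of UNIV sphere_measure "\<lambda>_. False"] by (simp add: sp)
      then show False using True by (simp add: measure_def)
    qed
    then obtain x where "g x = c" by blast
    then have "c = of_nat (\<theta> x * (if x \<in> A then 1 else 0))" by (auto simp: g_def)
    then show ?thesis using multiple[OF True] by metis
  next
    case False
    then have 0: "emeasure sphere_measure UNIV = 0"
      by (simp add: S.emeasure_eq_measure measure_nonneg order_class.order.antisym not_less)
    have "\<mu> = scale_measure (of_nat 0) sphere_measure"
    proof (rule measure_eqI)
      fix B assume B: "B \<in> sets \<mu>"
      have "emeasure sphere_measure B = 0"
        using 0 emeasure_mono[of B UNIV sphere_measure] by (simp add: \<mu>g)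
      then have "B \<in> null_sets sphere_measure" using B by (auto simp: \<mu>g)
      then have "emeasure \<mu> B = 0"
        unfolding d using absolutely_continuousI_density[OF gs] by (auto simp: absolutely_continuous_def)
      then show "emeasure \<mu> B = emeasure (scale_measure (of_nat 0) sphere_measure) B" by simp
    qed (simp add: \<mu>g)
    then show ?thesis by blast
  qed
qed

section \<open>Passage from the support to almost every point, and the conclusion\<close>

lemma AE_measure_support:
  fixes \<mu> :: "'a::second_countable_topology measure"
  assumes "sets \<mu> = sets borel"
  shows "AE x in \<mu>. x \<in> measure_support \<mu>"
proof -
  obtain F where F: "F \<subseteq> {U. open U \<and> emeasure \<mu> U = 0}" "countable F"
      "\<Union>F = \<Union>{U. open U \<and> emeasure \<mu> U = 0}"
    using Lindelof[of "{U. open U \<and> emeasure \<mu> U = 0}"] by auto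
  \<comment> \<open>By Lindelof the complement of the support is a union of countably many open null
    sets.\<close>
  have "\<Union>F \<in> null_sets \<mu>"
  proof -
    have "(\<Union>U\<in>F. U) \<in> null_sets \<mu>"
      by (rule null_sets_UN'[OF F(2)]) (use F(1) assms in \<open>auto simp: null_sets_def\<close>)
    then show ?thesis by simp
  qed
  then show ?thesis
    by (rule AE_I') (unfold F(3), auto simp: measure_support_def zero_less_iff_neq_zero)
qed

text \<open>The real values are genuine: a Radon measure is finite on the compact ball and
  \<open>H\<close> is square integrable, so neither \<open>measure\<close> nor the Bochner integral
  takes a default value.\<close>

theorem theorem1:
  fixes \<mu> :: "(real^3) measure" and H :: "real^3 \<Rightarrow> real^3"
  assumes "integral_2_varifold \<mu>"
    and "weak_mean_curvature_L2 \<mu> H"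
    and "measure_support \<mu> \<subseteq> cball 0 1"
  shows "(\<integral>x. 1 / 4 * (norm (H x))\<^sup>2 \<partial>completion \<mu>) \<ge> measure \<mu> (cball 0 1) \<and>
         ((\<integral>x. 1 / 4 * (norm (H x))\<^sup>2 \<partial>completion \<mu>) = measure \<mu> (cball 0 1) \<longleftrightarrow>
          (\<exists>k::nat. \<mu> = scale_measure (of_nat k) (measure_restr hausdorff2 (sphere 0 1))))"
proof -
  from assms(1) obtain A \<theta> where sets: "sets \<mu> = sets borel"
    and rad: "\<And>K. compact K \<Longrightarrow> emeasure \<mu> K < \<infinity>"
    and A: "A \<in> sets borel" and \<theta>: "\<theta> \<in> borel \<rightarrow>\<^sub>M count_space UNIV"
    and \<mu>: "\<mu> = density hausdorff2 (\<lambda>x. of_nat (\<theta> x) * indicator A x)"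
    unfolding integral_2_varifold_def radon_measure_def by blast
  have sp: "space \<mu> = UNIV" using sets_eq_imp_space_eq[OF sets] by simp
  have ball: "AE x in \<mu>. norm x \<le> 1"
    using AE_measure_support[OF sets] by eventually_elim (use assms(3) in auto)
  \<comment> \<open>The whole mass sits in a compact ball, so the Radon property makes \<mu>
    finite.\<close>
  have UNIV_eq: "emeasure \<mu> UNIV = emeasure \<mu> (cball 0 1)"
    using ball sets by (intro emeasure_eq_AE) auto
  interpret varifold_in_ball \<mu> H
  proof (rule varifold_in_ball.intro)
    show "finite_measure \<mu>"
      using rad[of "cball 0 1"] UNIV_eq by (intro finite_measureI) (simp add: sp)
  qed (use sets ball assms(2) in auto)
  have mass: "measure \<mu> (cball 0 1) = measure \<mu> UNIV" using UNIV_eq by (simp add: measure_def)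
  have four: "(\<integral>x. 1 / 4 * (norm (H x))\<^sup>2 \<partial>completion \<mu>) = (\<integral>x. (norm (H x))\<^sup>2 \<partial>completion \<mu>) / 4"
    by simp
  have "(\<integral>x. (norm (H x))\<^sup>2 \<partial>M) = 4 * measure \<mu> UNIV \<longleftrightarrow> (\<exists>k::nat. \<mu> = scale_measure (of_nat k) sphere_measure)"
  proof
    assume eq: "(\<integral>x. (norm (H x))\<^sup>2 \<partial>M) = 4 * measure \<mu> UNIV"
    have sphere: "AE x in \<mu>. norm x = 1"
      using curvature_equalityD(1)[OF eq] by (simp add: AE_completion_iff)
    interpret varifold_in_sphere \<mu> H by unfold_locales (rule sphere)
    note inv = rotation_invariant_if_curvature[OF curvature_equalityD(2)[OF eq]]
    \<comment> \<open>Proved for positive sphere mass only, as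
      \<open>proportional_imp_integral_multiple\<close> expects; that lemma settles the other case
      itself.\<close>
    have "\<mu> = scale_measure (ennreal (measure \<mu> UNIV / measure sphere_measure UNIV)) sphere_measure"
      if "measure sphere_measure UNIV > 0"
    proof (rule uniformly_distributed_measures_proportional[OF finite_mu sets _ finite_sphere_measure])
      show "AE x in \<mu>. x \<in> sphere 0 1" "AE x in sphere_measure. x \<in> sphere 0 1"
        using sphere AE_sphere_measure by simp_all
      fix x y :: "real^3" and r assume "x \<in> sphere 0 1" "y \<in> sphere 0 1"
      then have xy: "norm x = 1" "norm y = 1" by simp_all
      show "measure \<mu> (cball x r) = measure \<mu> (cball y r)"
        by (rule rotation_invariant_imp_uniformly_distributed[OF sets inv xy])
      show "measure sphere_measure (cball x r) = measure sphere_measure (cball y r)"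
        by (rule rotation_invariant_imp_uniformly_distributed[OF _ distr_rotation_sphere_measure xy]) simp_all
    qed (use that in simp_all)
    then show "\<exists>k::nat. \<mu> = scale_measure (of_nat k) sphere_measure"
      by (rule proportional_imp_integral_multiple[OF \<mu> A \<theta> sphere])
  next
    assume "\<exists>k::nat. \<mu> = scale_measure (of_nat k) sphere_measure"
    then obtain k :: nat where k: "\<mu> = scale_measure (of_nat k) sphere_measure" by blast
    have sphere: "AE x in \<mu>. norm x = 1"
      unfolding k scale_measure_eq_density using AE_sphere_measure by (subst AE_density) auto
    interpret varifold_in_sphere \<mu> H by unfold_locales (rule sphere)
    have em: "emeasure \<mu> B = of_nat k * emeasure sphere_measure B" for B
      by (simp add: k)
    \<comment> \<open>The curvature \<open>H\<close> is given and has to be identified: invariance,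
      inherited from the sphere measure, forces \<open>H x = - 2 *\<^sub>R x\<close> almost
      everywhere.\<close>
    have inv: "distr \<mu> borel (rotation u v t) = \<mu>" if uv: "norm u = 1" "norm v = 1" "u \<bullet> v = 0" for u v t
    proof (rule measure_eqI)
      have R: "rotation u v t \<in> borel_measurable \<mu>" "rotation u v t \<in> borel_measurable sphere_measure"
        using measurable_rotation sets by (simp_all cong: measurable_cong_sets)
      fix B assume "B \<in> sets (distr \<mu> borel (rotation u v t))"
      then have B: "B \<in> sets borel" by simp
      have sps: "space sphere_measure = UNIV"
        by (simp add: sets_eq_imp_space_eq[of sphere_measure borel])
      have "emeasure (distr \<mu> borel (rotation u v t)) B = emeasure \<mu> (rotation u v t -` B)"
        using B R by (subst emeasure_distr) (auto simp: sp)
      also have "\<dots> = of_nat k * emeasure sphere_measure (rotation u v t -` B)"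
        by (rule em)
      also have "emeasure sphere_measure (rotation u v t -` B) = emeasure (distr sphere_measure borel (rotation u v t)) B"
        using B R by (subst emeasure_distr) (auto simp: sps)
      also have "of_nat k * \<dots> = emeasure \<mu> B"
        by (simp only: distr_rotation_sphere_measure[OF uv] em)
      finally show "emeasure (distr \<mu> borel (rotation u v t)) B = emeasure \<mu> B" .
    qed (simp add: sets)
    show "(\<integral>x. (norm (H x))\<^sup>2 \<partial>M) = 4 * measure \<mu> UNIV"
      by (rule curvature_integral[OF curvature_if_rotation_invariant[OF inv]])
  qed
  moreover have "(\<integral>x. (norm (H x))\<^sup>2 \<partial>M) / 4 = measure \<mu> UNIV \<longleftrightarrow> (\<integral>x. (norm (H x))\<^sup>2 \<partial>M) = 4 * measure \<mu> UNIV"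
    by auto
  ultimately show ?thesis
    using curvature_lower_bound unfolding four mass by simp
qed

end
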